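(* Let $f$ be a $2\pi$-periodic, continuous, complex-valued function which has no zeros in $(-\pi,\pi]$. Then for every $\varepsilon>0$ the interval $[1-\varepsilon,1+\varepsilon]$ is a proper cluster for the singular values of $\mathcal{C}_n^{-1}(f)T_n(f)$.
   Context: $T_n(f)$ is the $n\times n$ Toeplitz matrix with $(j,k)$ entry $\frac{1}{2\pi}\int_{-\pi}^{\pi}f(x)\mathrm{e}^{-\mathrm{i}(j-k)x}\,\mathrm{d}x$. $\mathcal{C}_n(f)=\mathcal{F}_n^H\Lambda_n(f)\mathcal{F}_n$ is the circulant matrix with eigenvalues $f\left(\frac{2\pi(k-1)}{n}\right)$, $k=1,\dots,n$, where $\Lambda_n(f)$ is the diagonal matrix of these values (in this order) and $\mathcal{F}_n=\frac{1}{\sqrt n}\left(\omega^{(j-1)(k-1)}\right)_{j,k=1}^n$, $\omega=\mathrm{e}^{2\pi\mathrm{i}/n}$; $\mathcal{C}_n^{-1}(f)=(\mathcal{C}_n(f))^{-1}$. Proper cluster: $\Phi$ is a proper cluster for the singular values of $\{A_n\}$, $A_n\in\mathbb{C}^{n\times n}$, if for every $\delta>0$ the number of singular values of $A_n$ outside the $\delta$-extension of $\Phi$ (the union of $\Phi$ with all $\delta$-balls centred at its points) is bounded by a constant $c(\delta)$ independent of $n$. *)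

theory Defs
  imports
    "HOL-Analysis.Analysis"
    "Jordan_Normal_Form.Schur_Decomposition"
    "Jordan_Normal_Form.Gauss_Jordan_Elimination"
begin

(* Matrices are indexed from 0: with 1-based indices, j * k below reads (j - 1)(k - 1). *)

definition toeplitz_mat :: "nat \<Rightarrow> (real \<Rightarrow> complex) \<Rightarrow> complex mat" where
  "toeplitz_mat n f = Matrix.mat n n (\<lambda>(j, k).
     1 / (2 * of_real pi) *
     integral {-pi..pi} (\<lambda>x. f x * exp (- \<i> * of_int (int j - int k) * of_real x)))"

definition fourier_mat :: "nat \<Rightarrow> complex mat" where
  "fourier_mat n = (let \<omega> = exp (2 * of_real pi * \<i> / of_nat n) in
     Matrix.mat n n (\<lambda>(j, k). 1 / of_real (sqrt (real n)) * \<omega> ^ (j * k)))"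

definition circulant_eigenvalue_mat :: "nat \<Rightarrow> (real \<Rightarrow> complex) \<Rightarrow> complex mat" where
  "circulant_eigenvalue_mat n f = mat_diag n (\<lambda>k. f (2 * pi * real k / real n))"

definition circulant_mat :: "nat \<Rightarrow> (real \<Rightarrow> complex) \<Rightarrow> complex mat" where
  "circulant_mat n f =
     mat_adjoint (fourier_mat n) * circulant_eigenvalue_mat n f * fourier_mat n"

(* Unspecified if A is singular. *)
definition inverse_mat :: "'a :: field mat \<Rightarrow> 'a mat" where
  "inverse_mat A = the (mat_inverse A)"

(* Counted with multiplicity. The eigenvalues of the positive semidefinite matrix
   mat_adjoint A * A are real and nonnegative, so Re loses no information. *)
definition singular_values :: "complex mat \<Rightarrow> real multiset" where
  "singular_values A =
     image_mset (\<lambda>z. sqrt (Re z)) (proots (char_poly (mat_adjoint A * A)))"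

definition ball_extension :: "real \<Rightarrow> real set \<Rightarrow> real set" where
  "ball_extension \<delta> \<Phi> = \<Phi> \<union> (\<Union>x\<in>\<Phi>. ball x \<delta>)"

definition proper_singular_value_cluster :: "real set \<Rightarrow> (nat \<Rightarrow> complex mat) \<Rightarrow> bool" where
  "proper_singular_value_cluster \<Phi> A \<longleftrightarrow>
     (\<forall>\<delta>>0. \<exists>c::nat. \<forall>n\<ge>1.
        size {#\<sigma> \<in># singular_values (A n). \<sigma> \<notin> ball_extension \<delta> \<Phi>#} \<le> c)"

end

theory Submission
  imports Defs
begin

text \<open>Write \<open>C\<close> for the circulant matrix and \<open>T\<close> for the Toeplitz matrix of \<open>f\<close>, and let \<open>B = C\<^sup>-\<^sup>1 T\<close>.
The claim holds because \<open>B\<close> is the identity plus a small matrix plus a matrix whose rank is bounded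
independently of \<open>n\<close>, and such a perturbation moves only boundedly many singular values far away from 1.

Since \<open>f\<close> is continuous on the circle and has no zeros, \<open>\<bar>f\<bar> \<ge> \<mu> > 0\<close>. By Weierstrass
(\<open>trig_poly_approximation\<close>) \<open>f = p + g\<close> with a trigonometric polynomial \<open>p\<close> of some degree \<open>N\<close> and
\<open>\<bar>g\<bar> \<le> \<mu> e / 2\<close>. The Toeplitz and the circulant matrix of \<open>p\<close> have the same row \<open>j\<close> whenever
\<open>N \<le> j < n - N\<close>, as wrapping around modulo \<open>n\<close> then hits only vanishing Fourier coefficients
(\<open>toeplitz_eq_circulant_inner_rows\<close>). So the two matrices agree on the common kernel \<open>K\<close> of
at most \<open>2 N\<close> linear forms.

Both matrices of \<open>g\<close> have operator norm at most \<open>sup \<bar>g\<bar>\<close> (\<open>toeplitz_norm_le\<close>, \<open>circulant_norm_le\<close>), while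
\<open>C\<close> stretches every vector by at least \<open>\<mu>\<close> (\<open>circulant_norm_ge\<close>). For \<open>v\<close> in \<open>K\<close> the vector
\<open>w = B v - v\<close> satisfies \<open>C w = T v - C v\<close>, in which the contributions of \<open>p\<close> cancel, so the norm
of \<open>w\<close> is at most \<open>e\<close> times that of \<open>v\<close> (\<open>preconditioned_toeplitz_norm_bounds\<close>). Hence \<open>B\<close> distorts
lengths on \<open>K\<close> by a factor between \<open>1 - e\<close> and \<open>1 + e\<close>.

A dimension count in the style of Courant and Fischer finishes the proof
(\<open>few_singular_values_outside\<close>): if more than \<open>2 N\<close> singular values were below \<open>1 - e\<close>, the span of
the corresponding singular vectors would meet \<open>K\<close> in a vector that \<open>B\<close> shrinks too much, and
symmetrically above \<open>1 + e\<close>. The orthonormal singular vectors come from the spectral theorem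
\<open>hermitian_diagonalization\<close>, which also matches eigenvalues with the roots of the characteristic
polynomial including multiplicities. At most \<open>4 N\<close> singular values are exceptional, for every \<open>n\<close>.\<close>

unbundle no vec_syntax
unbundle no inner_syntax

section \<open>Adjoint matrices and the Euclidean norm\<close>

lemma mat_adjoint_carrier [simp]: "A \<in> carrier_mat m n \<Longrightarrow> mat_adjoint A \<in> carrier_mat n m"
  by (auto simp: mat_adjoint_def)

lemma mat_adjoint_index: "A \<in> carrier_mat m n \<Longrightarrow> i < n \<Longrightarrow> j < m \<Longrightarrow>
    mat_adjoint A $$ (i, j) = cnj (A $$ (j, i))"
  by (auto simp: mat_adjoint_def mat_of_rows_def)

lemma mat_adjoint_dims [simp]: "dim_row (mat_adjoint A) = dim_col A" "dim_col (mat_adjoint A) = dim_row A"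
  by (auto simp: mat_adjoint_def)

lemma mat_adjoint_mult:
  fixes A B :: "complex mat"
  assumes A: "A \<in> carrier_mat m k" and B: "B \<in> carrier_mat k n"
  shows "mat_adjoint (A * B) = mat_adjoint B * mat_adjoint A"
proof (rule eq_matI)
  fix i j assume "i < dim_row (mat_adjoint B * mat_adjoint A)" "j < dim_col (mat_adjoint B * mat_adjoint A)"
  then have i: "i < n" and j: "j < m" using A B by auto
  show "mat_adjoint (A * B) $$ (i, j) = (mat_adjoint B * mat_adjoint A) $$ (i, j)"
    using A B i j
    by (simp add: mat_adjoint_index[OF mult_carrier_mat[OF A B] i j] scalar_prod_def
         mat_adjoint_index[OF A] mat_adjoint_index[OF B] mult.commute)
qed (use A B in auto)

lemma mat_adjoint_mat_adjoint: 
  fixes A :: "complex mat" 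
  shows "mat_adjoint (mat_adjoint A) = A"
  by (rule eq_matI) (auto simp: mat_adjoint_index[of _ "dim_col A" "dim_row A"] mat_adjoint_index[of _ "dim_row A" "dim_col A"])

definition vnorm :: "complex vec \<Rightarrow> real" where
  "vnorm v = L2_set (\<lambda>i. cmod (v $ i)) {..<dim_vec v}"

lemma vnorm_nonneg [simp]: "0 \<le> vnorm v"
  by (simp add: vnorm_def)

lemma vnorm_square: "(vnorm v)\<^sup>2 = (\<Sum>i<dim_vec v. (cmod (v $ i))\<^sup>2)"
  by (simp add: vnorm_def L2_set_def sum_nonneg)

lemma vnorm_cscalar: "complex_of_real ((vnorm v)\<^sup>2) = v \<bullet>c v"
  unfolding vnorm_square scalar_prod_def
  by (simp add: complex_norm_square atLeast0LessThan del: of_real_power)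

lemma vnorm_eq_0: "v \<in> carrier_vec n \<Longrightarrow> vnorm v = 0 \<longleftrightarrow> v = 0\<^sub>v n"
  by (auto simp: vnorm_def L2_set_eq_0_iff)

lemma vnorm_add:
  assumes "u \<in> carrier_vec n" "v \<in> carrier_vec n"
  shows "vnorm (u + v) \<le> vnorm u + vnorm v"
proof -
  have "vnorm (u + v) \<le> L2_set (\<lambda>i. cmod (u $ i) + cmod (v $ i)) {..<n}"
    unfolding vnorm_def using assms by (auto intro!: L2_set_mono norm_triangle_ineq)
  also have "\<dots> \<le> vnorm u + vnorm v"
    using assms L2_set_triangle_ineq[of _ _ "{..<n}"] by (auto simp: vnorm_def)
  finally show ?thesis .
qed

lemma vnorm_minus:
  assumes "u \<in> carrier_vec n" "v \<in> carrier_vec n"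
  shows "vnorm (u - v) \<le> vnorm u + vnorm v"
proof -
  have "vnorm (u - v) \<le> L2_set (\<lambda>i. cmod (u $ i) + cmod (v $ i)) {..<n}"
    unfolding vnorm_def using assms by (auto intro!: L2_set_mono norm_triangle_ineq4)
  also have "\<dots> \<le> vnorm u + vnorm v"
    using assms L2_set_triangle_ineq[of _ _ "{..<n}"] by (auto simp: vnorm_def)
  finally show ?thesis .
qed

lemma cscalar_prod_mat_adjoint:
  assumes A: "A \<in> carrier_mat m n" and x: "x \<in> carrier_vec n" and y: "y \<in> carrier_vec m"
  shows "(A *\<^sub>v x) \<bullet>c y = x \<bullet>c (mat_adjoint A *\<^sub>v (y :: complex vec))"
proof -
  have "(A *\<^sub>v x) \<bullet>c y = (\<Sum>j<m. \<Sum>i<n. A $$ (j, i) * x $ i * cnj (y $ j))"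
    using assms by (simp add: scalar_prod_def sum_distrib_right atLeast0LessThan)
  also have "\<dots> = (\<Sum>i<n. \<Sum>j<m. A $$ (j, i) * x $ i * cnj (y $ j))"
    by (rule sum.swap)
  also have "\<dots> = x \<bullet>c (mat_adjoint A *\<^sub>v y)"
    using assms by (simp add: scalar_prod_def sum_distrib_left atLeast0LessThan mat_adjoint_index[OF A] mult_ac)
  finally show ?thesis .
qed

lemma vnorm_isometry:
  assumes U: "U \<in> carrier_mat n n" "mat_adjoint U * U = 1\<^sub>m n" and x: "x \<in> carrier_vec n"
  shows "vnorm (U *\<^sub>v x) = vnorm x"
proof -
  have "complex_of_real ((vnorm (U *\<^sub>v x))\<^sup>2) = x \<bullet>c (mat_adjoint U *\<^sub>v (U *\<^sub>v x))"
    unfolding vnorm_cscalar using U x by (subst cscalar_prod_mat_adjoint[of _ n n]) auto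
  also have "mat_adjoint U *\<^sub>v (U *\<^sub>v x) = x"
    using U x by (metis mat_adjoint_carrier assoc_mult_mat_vec one_mult_mat_vec)
  finally have "complex_of_real ((vnorm (U *\<^sub>v x))\<^sup>2) = complex_of_real ((vnorm x)\<^sup>2)"
    by (simp only: vnorm_cscalar)
  then show ?thesis by (simp only: of_real_eq_iff) (simp add: power2_eq_iff_nonneg)
qed

section \<open>Spectral theorem and counting of singular values\<close>

text \<open>The conditions on \<open>a\<close> are \<open>length L + (n - card S) < n\<close> homogeneous equations. As rows of a square
matrix padded with zero rows they have determinant 0, hence a nonzero common solution.\<close>

lemma common_kernel_exists:
  assumes L: "set L \<subseteq> carrier_vec n" and S: "S \<subseteq> {..<n}" and card: "length L < card S"
  obtains a :: "complex vec" where "a \<in> carrier_vec n" "a \<noteq> 0\<^sub>v n"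
    "\<And>l. l \<in> set L \<Longrightarrow> l \<bullet> a = 0" "\<And>i. i < n \<Longrightarrow> i \<notin> S \<Longrightarrow> a $ i = 0"
proof -
  define L' where "L' = L @ map (unit_vec n) (sorted_list_of_set ({..<n} - S))"
  have "length (sorted_list_of_set ({..<n} - S)) = n - card S"
    using S by (simp add: card_Diff_subset finite_subset)
  moreover have "card S \<le> n" using card_mono[OF _ S] by simp
  ultimately have len: "length L' < n" using card by (simp add: L'_def)
  \<comment> \<open>Row \<open>length L'\<close> exists because \<open>length L' < n\<close>; being zero, it makes the determinant vanish.\<close>
  define M where "M = mat\<^sub>r n n (\<lambda>i. if i = length L' then 0\<^sub>v n else if i < length L' then L' ! i else 0\<^sub>v n)"
  have M: "M \<in> carrier_mat n n" by (simp add: M_def)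
  have L'c: "set L' \<subseteq> carrier_vec n" using L by (auto simp: L'_def)
  have "det M = 0" unfolding M_def
    by (rule det_row_0) (use len L'c in \<open>auto intro: subsetD[OF L'c nth_mem]\<close>)
  then obtain a where a: "a \<in> carrier_vec n" "a \<noteq> 0\<^sub>v n" "M *\<^sub>v a = 0\<^sub>v n"
    using det_0_iff_vec_prod_zero[OF M] by blast
  have 1: "l \<bullet> a = 0" if l: "l \<in> set L'" for l
  proof -
    obtain i where i: "i < length L'" "l = L' ! i" using l by (auto simp: in_set_conv_nth)
    moreover have "l \<in> carrier_vec n" using l L'c by blast
    ultimately have "row M i = l" using len by (simp add: M_def)
    moreover have "(M *\<^sub>v a) $ i = 0" using a i len by simp
    ultimately show ?thesis using i len M by simp
  qed
  show thesis
  proof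
    show "l \<bullet> a = 0" if "l \<in> set L" for l using 1 that by (auto simp: L'_def)
    show "a $ i = 0" if "i < n" "i \<notin> S" for i
      using 1[of "unit_vec n i"] that a S by (auto simp: L'_def finite_subset)
  qed (use a in auto)
qed

text \<open>A normalised Gram-Schmidt completion of \<open>v\<close> to an orthogonal basis. The scalar \<open>c\<close> absorbs the length
of \<open>v\<close>, so that \<open>v\<close> itself need not be a unit vector.\<close>

lemma unitary_with_first_column:
  assumes v: "v \<in> carrier_vec n" "v \<noteq> 0\<^sub>v n"
  obtains W c where "W \<in> carrier_mat n n" "mat_adjoint W * W = 1\<^sub>m n"
    "col W 0 = c \<cdot>\<^sub>v (v :: complex vec)"
proof -
  interpret cof_vec_space n "TYPE(complex)" .
  have n: "0 < n" using v by (cases n) auto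
  define b where "b = basis_completion v"
  define ws where "ws = gram_schmidt n b"
  note bc = basis_completion[OF v, folded b_def]
  obtain vs where bv: "b = v # vs" using bc(6,7) n by (cases b) auto
  note gs = gram_schmidt_result[OF bc(2,4,5) refl, folded ws_def]
  have len: "length ws = n" using gs(4) bc(6) by simp
  have hd: "ws ! 0 = v"
    using gram_schmidt_hd[OF v(1), of vs] len n hd_conv_nth[of ws] unfolding ws_def bv by (metis length_0_conv less_numeral_extra(3))
  have wsc [simp]: "ws ! i \<in> carrier_vec n" if "i < n" for i
    using that gs(3) len by (auto intro: subsetD[OF gs(3) nth_mem])
  have orth: "ws ! i \<bullet>c ws ! j = 0 \<longleftrightarrow> i \<noteq> j" if "i < n" "j < n" for i j
    using corthogonalD[OF gs(2), of i j] that len by simp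
  define r where "r i = 1 / complex_of_real (vnorm (ws ! i))" for i
  define W where "W = mat_of_cols n (map (\<lambda>i. r i \<cdot>\<^sub>v ws ! i) [0..<n])"
  have W: "W \<in> carrier_mat n n" by (simp add: W_def mat_of_cols_carrier(1)[of n "map (\<lambda>i. r i \<cdot>\<^sub>v ws ! i) [0..<n]", simplified])
  have col: "col W i = r i \<cdot>\<^sub>v ws ! i" if "i < n" for i
    using that by (simp add: W_def)
  have "mat_adjoint W * W = 1\<^sub>m n"
  proof (rule eq_matI)
    fix i j assume "i < dim_row (1\<^sub>m n :: complex mat)" "j < dim_col (1\<^sub>m n :: complex mat)"
    then have i: "i < n" and j: "j < n" by auto
    have "(mat_adjoint W * W) $$ (i, j) = (\<Sum>k<n. cnj (col W i $ k) * col W j $ k)"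
      using W i j by (simp add: scalar_prod_def mat_adjoint_index[OF W] atLeast0LessThan)
    also have "\<dots> = (\<Sum>k<n. cnj (r i) * r j * (ws ! j $ k * cnj (ws ! i $ k)))"
      using i j by (simp add: col carrier_vecD[OF wsc] mult_ac)
    also have "\<dots> = cnj (r i) * r j * (ws ! j \<bullet>c ws ! i)"
      using i j by (simp add: scalar_prod_def sum_distrib_left atLeast0LessThan carrier_vecD[OF wsc])
    also have "\<dots> = (1\<^sub>m n :: complex mat) $$ (i, j)"
    proof (cases "i = j")
      case True
      have "ws ! i \<bullet>c ws ! i \<noteq> 0" using orth[OF i i] by simp
      then show ?thesis using True i
        by (simp add: r_def vnorm_cscalar[symmetric] power2_eq_square)
    qed (use orth[OF j i] i j in simp)
    finally show "(mat_adjoint W * W) $$ (i, j) = (1\<^sub>m n :: complex mat) $$ (i, j)" .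
  qed (use W in auto)
  then show thesis using that W col[OF n] hd by metis
qed

lemma mat_adjoint_block_diag:
  fixes U :: "complex mat"
  assumes "U \<in> carrier_mat m m"
  shows "mat_adjoint (four_block_mat (1\<^sub>m 1) (0\<^sub>m 1 m) (0\<^sub>m m 1) U)
    = four_block_mat (1\<^sub>m 1) (0\<^sub>m 1 m) (0\<^sub>m m 1) (mat_adjoint U)" (is "mat_adjoint ?F = ?G")
proof (rule eq_matI)
  have F: "?F \<in> carrier_mat (Suc m) (Suc m)" using assms by (auto intro!: carrier_matI)
  fix i j assume "i < dim_row ?G" "j < dim_col ?G"
  then have "i < Suc m" "j < Suc m" using assms by auto
  then have "mat_adjoint ?F $$ (i, j) = cnj (?F $$ (j, i))" "i < Suc m" "j < Suc m"
    by (simp_all only: mat_adjoint_index[OF F])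
  then show "mat_adjoint ?F $$ (i, j) = ?G $$ (i, j)"
    using assms by (auto simp: mat_adjoint_index[OF assms] less_Suc_eq_0_disj)
qed (use assms in auto)

text \<open>Deflation: a unitary matrix whose first column is an eigenvector for the first root \<open>e\<close> turns \<open>A\<close> into
a block matrix. Its first column is \<open>e\<close> times the first unit vector, and by
Hermitian symmetry the rest of its first row vanishes too, so the remaining block is Hermitian with
the remaining roots. Keeping the list of roots as given ties the diagonal to the algebraic
multiplicities, by which singular values are counted.\<close>

theorem hermitian_diagonalization:
  fixes A :: "complex mat"
  assumes "A \<in> carrier_mat n n" "mat_adjoint A = A" "char_poly A = (\<Prod>e\<leftarrow>es. [:- e, 1:])"
  shows "\<exists>U \<in> carrier_mat n n. mat_adjoint U * U = 1\<^sub>m n \<and>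
    mat_adjoint U * A * U = mat_diag n (\<lambda>i. es ! i)"
  using assms
proof (induction es arbitrary: n A)
  case Nil
  then have "n = 0" using degree_monic_char_poly[of A n] by simp
  then show ?case using Nil(1) by (intro bexI[of _ "1\<^sub>m 0"]) (auto intro!: eq_matI simp: mat_diag_def)
next
  case (Cons e es n A)
  note A = Cons.prems(1) and herm = Cons.prems(2)
  have cp: "char_poly A = [:-e, 1:] * (\<Prod>e\<leftarrow>es. [:- e, 1:])" using Cons.prems(3) by simp
  then have "eigenvalue A e" using eigenvalue_root_char_poly[OF A] by simp
  then obtain v where v: "v \<in> carrier_vec n" "v \<noteq> 0\<^sub>v n" "A *\<^sub>v v = e \<cdot>\<^sub>v v"
    using A by (auto simp: eigenvalue_def eigenvector_def)
  then have n: "n = Suc (n - 1)" by (cases n) auto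
  define m where "m = n - 1"
  have nm: "n = Suc m" using n by (simp add: m_def)
  obtain W c where W: "W \<in> carrier_mat n n" "mat_adjoint W * W = 1\<^sub>m n" "col W 0 = c \<cdot>\<^sub>v v"
    using unitary_with_first_column[OF v(1,2)] .
  have aW: "mat_adjoint W \<in> carrier_mat n n" using W by simp
  have WW: "W * mat_adjoint W = 1\<^sub>m n" using mat_mult_left_right_inverse[OF aW W(1,2)] .
  define B where "B = mat_adjoint W * A * W"
  have B: "B \<in> carrier_mat n n" using A W by (auto simp: B_def intro!: carrier_matI)
  have Bh: "mat_adjoint B = B"
    unfolding B_def using A W aW herm
    by (simp add: mat_adjoint_mult[of _ n n _ n] mat_adjoint_mat_adjoint assoc_mult_mat[of _ n n _ n _ n])
  have B0: "B $$ (i, 0) = (if i = 0 then e else 0)" if "i < n" for i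
  proof -
    have "B = mat_adjoint W * (A * W)"
      unfolding B_def by (rule assoc_mult_mat[OF aW A W(1)])
    then have "col B 0 = mat_adjoint W *\<^sub>v col (A * W) 0"
      using col_mult2[OF aW mult_carrier_mat[OF A W(1)], of 0] nm by simp
    also have "col (A * W) 0 = A *\<^sub>v col W 0"
      using col_mult2[OF A W(1), of 0] nm by simp
    also have "A *\<^sub>v col W 0 = e \<cdot>\<^sub>v col W 0"
      using A v W by (simp add: mult_mat_vec[of _ n n] smult_smult_assoc mult.commute)
    also have "mat_adjoint W *\<^sub>v (e \<cdot>\<^sub>v col W 0) = e \<cdot>\<^sub>v (mat_adjoint W *\<^sub>v col W 0)"
      using W aW v by (intro mult_mat_vec[of _ n n]) auto
    also have "mat_adjoint W *\<^sub>v col W 0 = col (mat_adjoint W * W) 0"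
      using col_mult2[OF aW W(1), of 0] nm by simp
    finally have "col B 0 = e \<cdot>\<^sub>v col (1\<^sub>m n) 0" using W by simp
    then have "col B 0 $ i = (e \<cdot>\<^sub>v col (1\<^sub>m n) 0) $ i" by simp
    then show ?thesis using that B nm by simp
  qed
  have B0': "B $$ (0, j) = 0" if "j < n" "j \<noteq> 0" for j
    using mat_adjoint_index[OF B, of 0 j] Bh B0[OF that(1)] that nm by simp
  define B3 where "B3 = Matrix.mat m m (\<lambda>(i, j). B $$ (Suc i, Suc j))"
  have B3: "B3 \<in> carrier_mat m m" by (simp add: B3_def)
  define E where "E = Matrix.mat 1 1 (\<lambda>_. e)"
  have E: "E \<in> carrier_mat 1 1" by (simp add: E_def)
  have Bblock: "B = four_block_mat E (0\<^sub>m 1 m) (0\<^sub>m m 1) B3"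
    by (rule eq_matI) (use B nm B0 B0' in \<open>auto simp: E_def B3_def less_Suc_eq_0_disj\<close>)
  have B3h: "mat_adjoint B3 = B3"
  proof (rule eq_matI)
    fix i j assume "i < dim_row B3" "j < dim_col B3"
    then have ij: "i < m" "j < m" using B3 by auto
    then have "mat_adjoint B3 $$ (i, j) = cnj (B $$ (Suc j, Suc i))"
      by (simp add: mat_adjoint_index[OF B3]) (simp add: B3_def)
    also have "\<dots> = mat_adjoint B $$ (Suc i, Suc j)"
      using ij nm by (simp add: mat_adjoint_index[OF B])
    finally show "mat_adjoint B3 $$ (i, j) = B3 $$ (i, j)" using ij Bh by (simp add: B3_def)
  qed (use B3 in auto)
  have "similar_mat B A"
    unfolding similar_mat_def
    by (intro exI[of _ "mat_adjoint W"] exI[of _ W])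
       (rule similar_mat_witI[OF W(2) WW B_def B A aW W(1)])
  then have "char_poly B = char_poly A" by (rule char_poly_similar)
  moreover have "char_poly B = char_poly E * char_poly B3"
    unfolding Bblock by (rule char_poly_four_block_zeros_col[OF E _ B3]) simp
  moreover have "char_poly E = [:-e, 1:]"
    by (simp add: E_def char_poly_defs det_def sign_def)
  ultimately have cp3: "char_poly B3 = (\<Prod>e\<leftarrow>es. [:- e, 1:])"
    using cp by (metis mult_cancel_left pCons_eq_0_iff zero_neq_one)
  obtain V where V: "V \<in> carrier_mat m m" "mat_adjoint V * V = 1\<^sub>m m"
      "mat_adjoint V * B3 * V = mat_diag m (\<lambda>i. es ! i)"
    using Cons.IH[OF B3 B3h cp3] by blast
  let ?F = "four_block_mat (1\<^sub>m 1) (0\<^sub>m 1 m) (0\<^sub>m m 1) V"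
  let ?G = "four_block_mat (1\<^sub>m 1) (0\<^sub>m 1 m) (0\<^sub>m m 1) (mat_adjoint V)"
  have F: "?F \<in> carrier_mat n n" using V nm by (auto intro!: carrier_matI)
  have G: "?G \<in> carrier_mat n n" using V nm by (auto intro!: carrier_matI)
  have FG: "mat_adjoint ?F = ?G" by (rule mat_adjoint_block_diag[OF V(1)])
  have GF: "?G * ?F = 1\<^sub>m n"
  proof -
    have "?G * ?F = four_block_mat (1\<^sub>m 1) (0\<^sub>m 1 m) (0\<^sub>m m 1) (1\<^sub>m m)"
      using V by (subst mult_four_block_mat[of _ 1 1 _ m _ m _ _ 1 _ m]) auto
    then show ?thesis using nm by (auto intro!: eq_matI)
  qed
  have GBF: "?G * B * ?F = mat_diag n (\<lambda>i. (e # es) ! i)"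
  proof -
    have "?G * B = four_block_mat E (0\<^sub>m 1 m) (0\<^sub>m m 1) (mat_adjoint V * B3)"
      unfolding Bblock using V B3 E by (subst mult_four_block_mat[of _ 1 1 _ m _ m _ _ 1 _ m]) auto
    also have "\<dots> * ?F = four_block_mat E (0\<^sub>m 1 m) (0\<^sub>m m 1) (mat_diag m (\<lambda>i. es ! i))"
      using V B3 E by (subst mult_four_block_mat[of _ 1 1 _ m _ m _ _ 1 _ m]) auto
    also have "\<dots> = mat_diag n (\<lambda>i. (e # es) ! i)"
      by (rule eq_matI) (use nm in \<open>auto simp: E_def mat_diag_def less_Suc_eq_0_disj split: if_splits\<close>)
    finally show ?thesis .
  qed
  show ?case
  proof (intro bexI[of _ "W * ?F"] conjI)
    show "W * ?F \<in> carrier_mat n n" using W F by simp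
    have adj: "mat_adjoint (W * ?F) = ?G * mat_adjoint W"
      by (simp only: mat_adjoint_mult[OF W(1) F] FG)
    have "mat_adjoint (W * ?F) * (W * ?F) = ?G * ((mat_adjoint W * W) * ?F)"
      unfolding adj by (simp only: assoc_mult_mat[OF G aW mult_carrier_mat[OF W(1) F]]
          assoc_mult_mat[OF aW W(1) F])
    also have "\<dots> = 1\<^sub>m n" by (simp only: W(2) left_mult_one_mat[OF F] GF)
    finally show "mat_adjoint (W * ?F) * (W * ?F) = 1\<^sub>m n" .
    have "mat_adjoint (W * ?F) * A * (W * ?F) = ?G * B * ?F"
      unfolding adj B_def
      by (simp only: assoc_mult_mat[OF G aW A]
          assoc_mult_mat[OF mult_carrier_mat[OF G mult_carrier_mat[OF aW A]] W(1) F, symmetric]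
          assoc_mult_mat[OF G mult_carrier_mat[OF aW A] W(1)])
    then show "mat_adjoint (W * ?F) * A * (W * ?F) = mat_diag n (\<lambda>i. (e # es) ! i)"
      using GBF by simp
  qed
qed

text \<open>The columns of \<open>U\<close> are the right singular vectors: diagonalising \<open>A\<^sup>* A\<close> expresses the squared length
of an image vector by the coordinates in that basis.\<close>

lemma singular_value_basis:
  assumes A: "A \<in> carrier_mat n n"
  obtains U \<sigma> where "U \<in> carrier_mat n n" "mat_adjoint U * U = 1\<^sub>m n"
    "length \<sigma> = n" "singular_values A = mset \<sigma>" "\<And>s. s \<in> set \<sigma> \<Longrightarrow> 0 \<le> s"
    "\<And>x. x \<in> carrier_vec n \<Longrightarrow> (vnorm (A *\<^sub>v (U *\<^sub>v x)))\<^sup>2 = (\<Sum>i<n. (\<sigma> ! i)\<^sup>2 * (cmod (x $ i))\<^sup>2)"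
proof -
  let ?H = "mat_adjoint A * A"
  have H: "?H \<in> carrier_mat n n" using A by (intro mult_carrier_mat[of _ n n]) auto
  have herm: "mat_adjoint ?H = ?H" using mat_adjoint_mult[of "mat_adjoint A" n n A n] A by (simp add: mat_adjoint_mat_adjoint)
  obtain es where es: "char_poly ?H = (\<Prod>e\<leftarrow>es. [:- e, 1:])" "length es = n"
    using char_poly_factorized[OF H] by blast
  obtain U where U: "U \<in> carrier_mat n n" "mat_adjoint U * U = 1\<^sub>m n"
      "mat_adjoint U * ?H * U = mat_diag n (\<lambda>i. es ! i)"
    using hermitian_diagonalization[OF H herm es(1)] by blast
  have aA: "mat_adjoint A \<in> carrier_mat n n" and aU: "mat_adjoint U \<in> carrier_mat n n"
    using A U by auto
  have eq: "(vnorm (A *\<^sub>v (U *\<^sub>v x)))\<^sup>2 = (\<Sum>i<n. Re (es ! i) * (cmod (x $ i))\<^sup>2)"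
    if x: "x \<in> carrier_vec n" for x
  proof -
    have Ux: "U *\<^sub>v x \<in> carrier_vec n" using U x by simp
    have "complex_of_real ((vnorm (A *\<^sub>v (U *\<^sub>v x)))\<^sup>2) = (U *\<^sub>v x) \<bullet>c (mat_adjoint A *\<^sub>v (A *\<^sub>v (U *\<^sub>v x)))"
      unfolding vnorm_cscalar using A Ux by (subst cscalar_prod_mat_adjoint[of _ n n]) auto
    also have "\<dots> = x \<bullet>c (mat_adjoint U *\<^sub>v (mat_adjoint A *\<^sub>v (A *\<^sub>v (U *\<^sub>v x))))"
      using A U x by (subst cscalar_prod_mat_adjoint[of _ n n]) (auto intro!: carrier_vecI)
    also have "mat_adjoint U *\<^sub>v (mat_adjoint A *\<^sub>v (A *\<^sub>v (U *\<^sub>v x))) = (mat_adjoint U * ?H * U) *\<^sub>v x"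
      by (simp only: assoc_mult_mat_vec[OF mult_carrier_mat[OF aU H] U(1) x]
          assoc_mult_mat_vec[OF aU H Ux] assoc_mult_mat_vec[OF aA A Ux])
    also have "x \<bullet>c (\<dots>) = (\<Sum>i<n. x $ i * cnj (es ! i * x $ i))"
      unfolding U(3) using x by (simp add: scalar_prod_def mat_diag_def atLeast0LessThan if_distrib[of "\<lambda>c. c * _"] cong: if_cong)
    also have "\<dots> = (\<Sum>i<n. cnj (es ! i) * complex_of_real ((cmod (x $ i))\<^sup>2))"
      by (rule sum.cong) (auto simp: complex_norm_square mult_ac simp del: of_real_power)
    finally have "Re (complex_of_real ((vnorm (A *\<^sub>v (U *\<^sub>v x)))\<^sup>2)) = Re (\<Sum>i<n. cnj (es ! i) * complex_of_real ((cmod (x $ i))\<^sup>2))"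
      by (rule arg_cong)
    then show ?thesis by (simp add: Re_sum del: of_real_power)
  qed
  \<comment> \<open>An eigenvalue is the squared length of the image of its unit eigenvector.\<close>
  have nonneg: "0 \<le> Re (es ! i)" if "i < n" for i
  proof -
    have "(\<Sum>j<n. Re (es ! j) * (cmod ((unit_vec n i :: complex vec) $ j))\<^sup>2) = Re (es ! i)"
      using that by (simp add: if_distrib[of cmod] if_distrib[of "\<lambda>c. c\<^sup>2"] if_distrib[of "\<lambda>c. _ * c"] cong: if_cong)
    then show ?thesis using eq[of "unit_vec n i"] by (metis unit_vec_carrier zero_le_power2)
  qed
  define \<sigma> where "\<sigma> = map (\<lambda>z. sqrt (Re z)) es"
  have "proots (\<Prod>e\<leftarrow>es. [:- e, 1:]) = mset es"
  proof (induction es)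
    case (Cons e es)
    have "(\<Prod>e\<leftarrow>es. [:- e, 1:]) \<noteq> 0" by (auto simp: prod_list_zero_iff)
    then show ?case using Cons by (simp add: proots_mult del: mult_pCons_left)
  qed simp
  then have sv: "singular_values A = mset \<sigma>"
    unfolding singular_values_def es(1) by (simp add: \<sigma>_def)
  show thesis
  proof (rule that[OF U(1,2) _ sv])
    show "length \<sigma> = n" by (simp add: \<sigma>_def es(2))
    show "0 \<le> s" if "s \<in> set \<sigma>" for s
      using that nonneg es(2) by (auto simp: \<sigma>_def in_set_conv_nth)
    show "(vnorm (A *\<^sub>v (U *\<^sub>v x)))\<^sup>2 = (\<Sum>i<n. (\<sigma> ! i)\<^sup>2 * (cmod (x $ i))\<^sup>2)" if "x \<in> carrier_vec n" for x
      using eq[OF that] nonneg es(2) by (simp add: \<sigma>_def)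
  qed
qed


text \<open>The span of the singular vectors with index in \<open>S\<close> has more dimensions than \<open>L\<close> has linear forms, so
it contains a nonzero vector \<open>v\<close> of their common kernel; \<open>x\<close> is the coordinate vector of \<open>v\<close>.\<close>

lemma kernel_vector_in_singular_subspace:
  fixes A :: "complex mat"
  assumes U: "U \<in> carrier_mat n n" "mat_adjoint U * U = 1\<^sub>m n"
    and A: "\<And>x. x \<in> carrier_vec n \<Longrightarrow>
      (vnorm (A *\<^sub>v (U *\<^sub>v x)))\<^sup>2 = (\<Sum>i<n. (\<sigma> ! i)\<^sup>2 * (cmod (x $ i))\<^sup>2)"
    and L: "set L \<subseteq> carrier_vec n" and S: "S \<subseteq> {..<n}" "length L < card S"
  shows "\<exists>v x. v \<in> carrier_vec n \<and> (\<forall>l\<in>set L. l \<bullet> v = 0) \<and> (\<exists>i\<in>S. x $ i \<noteq> 0) \<and>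
    (vnorm v)\<^sup>2 = (\<Sum>i\<in>S. (cmod (x $ i))\<^sup>2) \<and>
    (vnorm (A *\<^sub>v v))\<^sup>2 = (\<Sum>i\<in>S. (\<sigma> ! i)\<^sup>2 * (cmod (x $ i))\<^sup>2)"
proof -
  let ?M = "mat_of_rows n L"
  have M: "?M \<in> carrier_mat (length L) n" by simp
  have "set (rows (?M * U)) \<subseteq> carrier_vec n" using U by (auto simp: rows_def intro!: carrier_vecI)
  moreover have "length (rows (?M * U)) = length L" by simp
  ultimately obtain x where x: "x \<in> carrier_vec n" "x \<noteq> 0\<^sub>v n"
      "\<And>l. l \<in> set (rows (?M * U)) \<Longrightarrow> l \<bullet> x = 0" "\<And>i. i < n \<Longrightarrow> i \<notin> S \<Longrightarrow> x $ i = 0"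
    using common_kernel_exists[of "rows (?M * U)" n S] S by auto
  have Ux: "U *\<^sub>v x \<in> carrier_vec n" using U x by simp
  have "l \<bullet> (U *\<^sub>v x) = 0" if l: "l \<in> set L" for l
  proof -
    obtain i where i: "i < length L" "L ! i = l" using l by (auto simp: in_set_conv_nth)
    then have "l \<bullet> (U *\<^sub>v x) = (?M *\<^sub>v (U *\<^sub>v x)) $ i" using l L by (auto simp: mat_of_rows_row)
    also have "\<dots> = ((?M * U) *\<^sub>v x) $ i" using M U x by (simp add: assoc_mult_mat_vec[of _ "length L" n _ n])
    also have "\<dots> = row (?M * U) i \<bullet> x" using i by simp
    also have "\<dots> = 0" using i by (intro x(3)) (auto simp: rows_def)
    finally show ?thesis .
  qed
  moreover have "(vnorm (U *\<^sub>v x))\<^sup>2 = (\<Sum>i\<in>S. (cmod (x $ i))\<^sup>2)"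
    unfolding vnorm_isometry[OF U x(1)] vnorm_square using S x by (intro sum.mono_neutral_right) auto
  moreover have "(vnorm (A *\<^sub>v (U *\<^sub>v x)))\<^sup>2 = (\<Sum>i\<in>S. (\<sigma> ! i)\<^sup>2 * (cmod (x $ i))\<^sup>2)"
    unfolding A[OF x(1)] using S x by (intro sum.mono_neutral_right) auto
  moreover have "\<exists>i\<in>S. x $ i \<noteq> 0" using x by (metis eq_vecI carrier_vecD index_zero_vec)
  ultimately show ?thesis using Ux by blast
qed

text \<open>One half of the Courant-Fischer principle, applied to each side of the interval. On the span of the
singular vectors with singular value below \<open>a\<close>, nonzero vectors are shrunk by more than the factor
\<open>a\<close>; if that span had dimension above \<open>length L\<close>, it would meet the common kernel, on which \<open>A\<close> does
not shrink that much.\<close>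

lemma few_singular_values_outside:
  fixes A :: "complex mat"
  assumes A: "A \<in> carrier_mat n n" and L: "set L \<subseteq> carrier_vec n" and ab: "0 \<le> a" "0 \<le> b"
    and bounds: "\<And>v. v \<in> carrier_vec n \<Longrightarrow> (\<And>l. l \<in> set L \<Longrightarrow> l \<bullet> v = 0) \<Longrightarrow>
      a * vnorm v \<le> vnorm (A *\<^sub>v v) \<and> vnorm (A *\<^sub>v v) \<le> b * vnorm v"
  shows "size {#s \<in># singular_values A. s \<notin> {a..b}#} \<le> 2 * length L"
proof -
  obtain U \<sigma> where U: "U \<in> carrier_mat n n" "mat_adjoint U * U = 1\<^sub>m n"
    and \<sigma>: "length \<sigma> = n" "singular_values A = mset \<sigma>" "\<And>s. s \<in> set \<sigma> \<Longrightarrow> 0 \<le> s"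
    and AU: "\<And>x. x \<in> carrier_vec n \<Longrightarrow>
      (vnorm (A *\<^sub>v (U *\<^sub>v x)))\<^sup>2 = (\<Sum>i<n. (\<sigma> ! i)\<^sup>2 * (cmod (x $ i))\<^sup>2)"
    using singular_value_basis[OF A] by blast
  let ?S = "{i. i < n \<and> \<sigma> ! i < a}" and ?T = "{i. i < n \<and> b < \<sigma> ! i}"
  have "\<not> length L < card ?S"
  proof
    assume card: "length L < card ?S"
    have sub: "?S \<subseteq> {..<n}" by auto
    have "\<exists>v x. v \<in> carrier_vec n \<and> (\<forall>l\<in>set L. l \<bullet> v = 0) \<and> (\<exists>i\<in>?S. x $ i \<noteq> 0) \<and>
        (vnorm v)\<^sup>2 = (\<Sum>i\<in>?S. (cmod (x $ i))\<^sup>2) \<and>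
        (vnorm (A *\<^sub>v v))\<^sup>2 = (\<Sum>i\<in>?S. (\<sigma> ! i)\<^sup>2 * (cmod (x $ i))\<^sup>2)"
      by (rule kernel_vector_in_singular_subspace[OF U AU L sub card])
    then obtain v x where v: "v \<in> carrier_vec n" "\<forall>l\<in>set L. l \<bullet> v = 0" "\<exists>i\<in>?S. x $ i \<noteq> 0"
        "(vnorm v)\<^sup>2 = (\<Sum>i\<in>?S. (cmod (x $ i))\<^sup>2)"
        "(vnorm (A *\<^sub>v v))\<^sup>2 = (\<Sum>i\<in>?S. (\<sigma> ! i)\<^sup>2 * (cmod (x $ i))\<^sup>2)"
      by (elim exE conjE)
    have less: "(\<sigma> ! i)\<^sup>2 < a\<^sup>2" if "i \<in> ?S" for i
      using that \<sigma> by (intro power_strict_mono) auto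
    have "(\<Sum>i\<in>?S. (\<sigma> ! i)\<^sup>2 * (cmod (x $ i))\<^sup>2) < (\<Sum>i\<in>?S. a\<^sup>2 * (cmod (x $ i))\<^sup>2)"
    proof (rule sum_strict_mono_ex1)
      show "\<exists>i\<in>?S. (\<sigma> ! i)\<^sup>2 * (cmod (x $ i))\<^sup>2 < a\<^sup>2 * (cmod (x $ i))\<^sup>2"
        using v(3) less by (meson mult_strict_right_mono norm_eq_zero zero_less_power2)
      show "\<forall>i\<in>?S. (\<sigma> ! i)\<^sup>2 * (cmod (x $ i))\<^sup>2 \<le> a\<^sup>2 * (cmod (x $ i))\<^sup>2"
        by (intro ballI mult_right_mono less_imp_le[OF less]) auto
    qed simp
    then have "(vnorm (A *\<^sub>v v))\<^sup>2 < (a * vnorm v)\<^sup>2"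
      unfolding v(5) power_mult_distrib v(4) sum_distrib_left .
    moreover have "(a * vnorm v)\<^sup>2 \<le> (vnorm (A *\<^sub>v v))\<^sup>2"
      using bounds[OF v(1) bspec[OF v(2)]] ab by (intro power_mono) auto
    ultimately show False by simp
  qed
  moreover have "\<not> length L < card ?T"
  proof
    assume card: "length L < card ?T"
    have sub: "?T \<subseteq> {..<n}" by auto
    have "\<exists>v x. v \<in> carrier_vec n \<and> (\<forall>l\<in>set L. l \<bullet> v = 0) \<and> (\<exists>i\<in>?T. x $ i \<noteq> 0) \<and>
        (vnorm v)\<^sup>2 = (\<Sum>i\<in>?T. (cmod (x $ i))\<^sup>2) \<and>
        (vnorm (A *\<^sub>v v))\<^sup>2 = (\<Sum>i\<in>?T. (\<sigma> ! i)\<^sup>2 * (cmod (x $ i))\<^sup>2)"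
      by (rule kernel_vector_in_singular_subspace[OF U AU L sub card])
    then obtain v x where v: "v \<in> carrier_vec n" "\<forall>l\<in>set L. l \<bullet> v = 0" "\<exists>i\<in>?T. x $ i \<noteq> 0"
        "(vnorm v)\<^sup>2 = (\<Sum>i\<in>?T. (cmod (x $ i))\<^sup>2)"
        "(vnorm (A *\<^sub>v v))\<^sup>2 = (\<Sum>i\<in>?T. (\<sigma> ! i)\<^sup>2 * (cmod (x $ i))\<^sup>2)"
      by (elim exE conjE)
    have less: "b\<^sup>2 < (\<sigma> ! i)\<^sup>2" if "i \<in> ?T" for i
      using that ab by (intro power_strict_mono) auto
    have "(\<Sum>i\<in>?T. b\<^sup>2 * (cmod (x $ i))\<^sup>2) < (\<Sum>i\<in>?T. (\<sigma> ! i)\<^sup>2 * (cmod (x $ i))\<^sup>2)"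
    proof (rule sum_strict_mono_ex1)
      show "\<exists>i\<in>?T. b\<^sup>2 * (cmod (x $ i))\<^sup>2 < (\<sigma> ! i)\<^sup>2 * (cmod (x $ i))\<^sup>2"
        using v(3) less by (meson mult_strict_right_mono norm_eq_zero zero_less_power2)
      show "\<forall>i\<in>?T. b\<^sup>2 * (cmod (x $ i))\<^sup>2 \<le> (\<sigma> ! i)\<^sup>2 * (cmod (x $ i))\<^sup>2"
        by (intro ballI mult_right_mono less_imp_le[OF less]) auto
    qed simp
    then have "(b * vnorm v)\<^sup>2 < (vnorm (A *\<^sub>v v))\<^sup>2"
      unfolding v(5) power_mult_distrib v(4) sum_distrib_left .
    moreover have "(vnorm (A *\<^sub>v v))\<^sup>2 \<le> (b * vnorm v)\<^sup>2"
      using bounds[OF v(1) bspec[OF v(2)]] by (intro power_mono) auto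
    ultimately show False by simp
  qed
  moreover have "size {#s \<in># singular_values A. s \<notin> {a..b}#} = card {i. i < n \<and> \<sigma> ! i \<notin> {a..b}}"
    unfolding \<sigma>(2) mset_filter[symmetric] size_mset length_filter_conv_card \<sigma>(1) ..
  moreover have "card {i. i < n \<and> \<sigma> ! i \<notin> {a..b}} \<le> card ?S + card ?T"
    by (rule order_trans[OF card_mono card_Un_le]) auto
  ultimately show ?thesis by linarith
qed

section \<open>Trigonometric approximation of periodic functions\<close>

definition is_trig_poly :: "(real \<Rightarrow> complex) \<Rightarrow> bool" where
  "is_trig_poly p \<longleftrightarrow> (\<exists>M c. finite M \<and> p = (\<lambda>x. \<Sum>m\<in>M. c m * cis (of_int m * x)))"

lemma trig_poly_monomial: "is_trig_poly (\<lambda>x. c * cis (of_int m * x))"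
  unfolding is_trig_poly_def by (rule exI[of _ "{m}"], rule exI[of _ "\<lambda>_. c"]) auto

lemma trig_poly_add:
  assumes "is_trig_poly p" "is_trig_poly q" shows "is_trig_poly (\<lambda>x. p x + q x)"
proof -
  obtain M c where M: "finite M" "p = (\<lambda>x. \<Sum>m\<in>M. c m * cis (of_int m * x))"
    using assms unfolding is_trig_poly_def by auto
  obtain K d where K: "finite K" "q = (\<lambda>x. \<Sum>m\<in>K. d m * cis (of_int m * x))"
    using assms unfolding is_trig_poly_def by auto
  have "p x + q x = (\<Sum>m\<in>M \<union> K. ((if m \<in> M then c m else 0) + (if m \<in> K then d m else 0)) * cis (of_int m * x))" for x
  proof -
    have "p x = (\<Sum>m\<in>M \<union> K. (if m \<in> M then c m else 0) * cis (of_int m * x))"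
      unfolding M(2) by (rule sum.mono_neutral_cong_left) (use M K in auto)
    moreover have "q x = (\<Sum>m\<in>M \<union> K. (if m \<in> K then d m else 0) * cis (of_int m * x))"
      unfolding K(2) by (rule sum.mono_neutral_cong_left) (use M K in auto)
    ultimately show ?thesis by (simp only: sum.distrib distrib_right)
  qed
  then have "(\<lambda>x. p x + q x) = (\<lambda>x. \<Sum>m\<in>M \<union> K. ((if m \<in> M then c m else 0) + (if m \<in> K then d m else 0)) * cis (of_int m * x))"
    by (rule ext)
  moreover have "finite (M \<union> K)" using M K by simp
  ultimately show ?thesis unfolding is_trig_poly_def by (intro exI conjI)
qed

lemma trig_poly_sum:
  "finite I \<Longrightarrow> (\<And>i. i \<in> I \<Longrightarrow> is_trig_poly (p i)) \<Longrightarrow> is_trig_poly (\<lambda>x. \<Sum>i\<in>I. p i x)"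
proof (induction I rule: finite_induct)
  case empty
  show ?case using trig_poly_monomial[of 0 0] by simp
qed (simp add: trig_poly_add)

lemma trig_poly_mult:
  assumes "is_trig_poly p" "is_trig_poly q" shows "is_trig_poly (\<lambda>x. p x * q x)"
proof -
  obtain M c where M: "finite M" "p = (\<lambda>x. \<Sum>m\<in>M. c m * cis (of_int m * x))"
    using assms unfolding is_trig_poly_def by auto
  obtain K d where K: "finite K" "q = (\<lambda>x. \<Sum>m\<in>K. d m * cis (of_int m * x))"
    using assms unfolding is_trig_poly_def by auto
  have eq: "p x * q x = (\<Sum>m\<in>M. \<Sum>k\<in>K. (c m * d k) * cis (of_int (m + k) * x))" for x
    unfolding M(2) K(2) sum_product
    by (intro sum.cong refl) (simp add: cis_mult ring_distribs)
  show ?thesis unfolding eq by (intro trig_poly_sum trig_poly_monomial M(1) K(1))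
qed

text \<open>Polynomial functions of the real and imaginary part of \<open>cis x\<close> are generated from linear ones, and
a linear function of \<open>cis x\<close> is a combination of \<open>cis x\<close> and \<open>cis (- x)\<close>.\<close>

lemma trig_poly_real_polynomial_cis:
  assumes "real_polynomial_function h"
  shows "is_trig_poly (\<lambda>x. of_real (h (cis x)))"
  using assms
proof (induction)
  case (linear h)
  have eq: "complex_of_real (h (cis x)) = ((of_real (h 1) - \<i> * of_real (h \<i>)) / 2) * cis (of_int 1 * x) +
     ((of_real (h 1) + \<i> * of_real (h \<i>)) / 2) * cis (of_int (-1) * x)" for x
  proof -
    have "cis x = cos x *\<^sub>R 1 + sin x *\<^sub>R \<i>" by (simp add: complex_eq_iff)
    then have "h (cis x) = cos x * h 1 + sin x * h \<i>"
      by (simp add: linear bounded_linear.linear linear_add linear_scale)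
    then show ?thesis by (simp add: complex_eq_iff field_simps)
  qed
  show ?case unfolding eq by (intro trig_poly_add trig_poly_monomial)
next
  case (const c)
  show ?case using trig_poly_monomial[of "of_real c" 0] by simp
qed (simp_all add: trig_poly_add trig_poly_mult)

lemma periodic_shift:
  fixes f :: "real \<Rightarrow> complex"
  assumes "\<And>x. f (x + 2 * pi) = f x"
  shows "f (x + 2 * pi * of_int k) = f x"
proof -
  have 1: "f (y + 2 * pi * of_nat n) = f y" for n y
  proof (induction n)
    case (Suc n)
    have "f (y + 2 * pi * of_nat (Suc n)) = f ((y + 2 * pi * of_nat n) + 2 * pi)"
      by (rule arg_cong[of _ _ f]) (simp add: algebra_simps)
    then show ?case unfolding assms Suc .
  qed simp
  show ?thesis
  proof (cases "k \<ge> 0")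
    case True
    then have "real_of_int k = of_nat (nat k)" by simp
    then show ?thesis using 1[of x "nat k"] by metis
  next
    case False
    then have "x = x + 2 * pi * of_int k + 2 * pi * of_nat (nat (-k))" by simp
    then show ?thesis using 1[of "x + 2 * pi * of_int k" "nat (-k)"] by metis
  qed
qed

lemma periodic_Arg_cis:
  fixes f :: "real \<Rightarrow> complex"
  assumes "\<And>x. f (x + 2 * pi) = f x"
  shows "f (Arg (cis x)) = f x"
proof -
  have "cis (Arg (cis x)) = cis x" by (simp add: cis_Arg)
  then have "cos (Arg (cis x)) = cos x" "sin (Arg (cis x)) = sin x" by (simp_all add: complex_eq_iff)
  then obtain k where "Arg (cis x) = x + 2 * pi * of_int k"
    using sin_cos_eq_iff[of "Arg (cis x)" x] by auto
  then show ?thesis using periodic_shift[of f x k, OF assms] by metis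
qed

text \<open>Continuity of \<open>F\<close> cannot be read off from that of the argument function, which jumps at \<open>-1\<close>.
Instead, \<open>cis\<close> maps a compact interval onto the circle and is therefore a quotient map.\<close>

lemma periodic_factors_through_circle:
  fixes f :: "real \<Rightarrow> complex"
  assumes per: "\<And>x. f (x + 2 * pi) = f x" and cont: "continuous_on UNIV f"
  obtains F where "continuous_on (sphere 0 1) F" "\<And>x. F (cis x) = f x"
proof -
  define F where "F z = f (Arg z)" for z
  have F: "F (cis x) = f x" for x
    unfolding F_def by (rule periodic_Arg_cis[of f x, OF per])
  have img: "cis ` {-pi..pi} = sphere 0 1"
  proof -
    have "z \<in> cis ` {-pi..pi}" if "norm z = 1" for z
    proof -
      have "z \<noteq> 0" using that by auto
      then have "z = cis (Arg z)" using that by (simp add: cis_Arg sgn_div_norm)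
      moreover have "Arg z \<in> {-pi..pi}" using Arg_bounded[of z] by auto
      ultimately show ?thesis by (rule image_eqI)
    qed
    then show ?thesis by auto
  qed
  have "continuous_on (sphere 0 1) F"
  proof (subst continuous_on_open_gen[of _ _ UNIV], simp, intro allI impI)
    fix U :: "complex set" assume "openin (top_of_set UNIV) U"
    then have "open U" by simp
    have "openin (top_of_set {-pi..pi}) ({-pi..pi} \<inter> cis -` (sphere 0 1 \<inter> F -` U)) \<longleftrightarrow>
       openin (top_of_set (sphere 0 1)) (sphere 0 1 \<inter> F -` U)"
      by (rule Abstract_Topology_2.continuous_imp_quotient_map[OF _ img]) (auto intro!: continuous_intros)
    moreover have "{-pi..pi} \<inter> cis -` (sphere 0 1 \<inter> F -` U) = {-pi..pi} \<inter> f -` U"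
      using F by auto
    moreover have "openin (top_of_set {-pi..pi}) ({-pi..pi} \<inter> f -` U)"
      using cont \<open>open U\<close> by (meson continuous_on_subset continuous_openin_preimage_gen subset_UNIV)
    ultimately show "openin (top_of_set (sphere 0 1)) (sphere 0 1 \<inter> F -` U)" by simp
  qed
  then show thesis using F that by blast
qed

lemma trig_poly_approximation:
  fixes f :: "real \<Rightarrow> complex"
  assumes per: "\<And>x. f (x + 2 * pi) = f x" and cont: "continuous_on UNIV f" and e: "0 < e"
  obtains p where "is_trig_poly p" "\<And>x. cmod (f x - p x) < e"
proof -
  obtain F where F: "continuous_on (sphere 0 1) F" "\<And>x. F (cis x) = f x"
    using periodic_factors_through_circle[OF per cont] by blast
  obtain g where g: "polynomial_function g" "\<And>z. z \<in> sphere 0 1 \<Longrightarrow> norm (F z - g z) < e"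
    using Stone_Weierstrass_polynomial_function[OF _ F(1) e] by auto
  have re: "real_polynomial_function (\<lambda>z. Re (g z))" "real_polynomial_function (\<lambda>z. Im (g z))"
    using g(1) bounded_linear_Re bounded_linear_Im unfolding polynomial_function_def by (auto simp: o_def)
  have "is_trig_poly (\<lambda>x. of_real (Re (g (cis x))) + (\<i> * cis (of_int 0 * x)) * of_real (Im (g (cis x))))"
    by (intro trig_poly_add trig_poly_mult trig_poly_monomial trig_poly_real_polynomial_cis re)
  moreover have "of_real (Re (g (cis x))) + (\<i> * cis (of_int 0 * x)) * of_real (Im (g (cis x))) = g (cis x)" for x
    by (simp add: complex_eq_iff)
  ultimately have "is_trig_poly (\<lambda>x. g (cis x))" by simp
  moreover have "cmod (f x - g (cis x)) < e" for x using g(2)[of "cis x"] F(2) by simp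
  ultimately show thesis using that by blast
qed

lemma periodic_nonzero_bounded_below:
  fixes f :: "real \<Rightarrow> complex"
  assumes per: "\<And>x. f (x + 2 * pi) = f x" and cont: "continuous_on UNIV f"
    and nz: "\<And>x. x \<in> {-pi<..pi} \<Longrightarrow> f x \<noteq> 0"
  obtains \<mu> where "0 < \<mu>" "\<And>x. \<mu> \<le> cmod (f x)"
proof -
  have "continuous_on {-pi..pi} (\<lambda>x. cmod (f x))"
    by (intro continuous_intros continuous_on_subset[OF cont]) auto
  then have "\<exists>y\<in>{-pi..pi}. \<forall>x\<in>{-pi..pi}. cmod (f y) \<le> cmod (f x)"
    by (rule continuous_attains_inf[rotated 2]) auto
  then obtain y where y: "\<forall>x\<in>{-pi..pi}. cmod (f y) \<le> cmod (f x)" "y \<in> {-pi..pi}"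
    by blast
  have "f y \<noteq> 0" using nz[of y] nz[of pi] per[of "-pi"] y(2) by (cases "y = -pi") auto
  moreover have "cmod (f y) \<le> cmod (f x)" for x
    using bspec[OF y(1), of "Arg (cis x)"] Arg_bounded[of "cis x"] periodic_Arg_cis[of f x, OF per] by simp
  ultimately show thesis using that[of "cmod (f y)"] by auto
qed

section \<open>Toeplitz matrices\<close>

definition fourier_coeff :: "(real \<Rightarrow> complex) \<Rightarrow> int \<Rightarrow> complex" where
  "fourier_coeff f d = 1 / (2 * of_real pi) * integral {-pi..pi} (\<lambda>x. f x * cis (- of_int d * x))"

lemma toeplitz_index:
  "j < n \<Longrightarrow> k < n \<Longrightarrow> toeplitz_mat n f $$ (j, k) = fourier_coeff f (int j - int k)"
  by (simp add: toeplitz_mat_def fourier_coeff_def cis_conv_exp algebra_simps)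

lemma toeplitz_carrier [simp]: "toeplitz_mat n f \<in> carrier_mat n n"
  by (simp add: toeplitz_mat_def)

lemma toeplitz_dims [simp]: "dim_row (toeplitz_mat n f) = n" "dim_col (toeplitz_mat n f) = n"
  by (simp_all add: toeplitz_mat_def)

lemma integral_cis: "integral {-pi..pi} (\<lambda>x. cis (of_int m * x)) = (if m = 0 then 2 * of_real pi else 0)"
proof (cases "m = 0")
  case False
  define F where "F z = exp (\<i> * of_int m * z) / (\<i> * of_int m)" for z :: complex
  have "((\<lambda>x. F (of_real x)) has_vector_derivative cis (of_int m * x)) (at x within {-pi..pi})" for x
  proof -
    have "(F has_field_derivative exp (\<i> * of_int m * of_real x)) (at (of_real x))"
      unfolding F_def using False by (auto intro!: derivative_eq_intros)
    then have "((\<lambda>x. F (of_real x)) has_vector_derivative exp (\<i> * of_int m * of_real x)) (at x)"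
      by (rule has_vector_derivative_real_field)
    then show ?thesis by (simp add: cis_conv_exp mult_ac has_vector_derivative_at_within)
  qed
  then have "((\<lambda>x. cis (of_int m * x)) has_integral (F (of_real pi) - F (of_real (-pi)))) {-pi..pi}"
    by (intro fundamental_theorem_of_calculus) auto
  moreover have "F (of_real pi) = F (of_real (-pi))"
  proof -
    have "exp (\<i> * of_int m * of_real t) = cis (of_int m * t)" for t
      by (simp add: cis_conv_exp mult_ac)
    moreover have "cis (of_int m * pi) = cis (of_int m * (-pi))"
    proof -
      have "sin (of_int m * pi) = sin (of_int m * (-pi)) \<and> cos (of_int m * pi) = cos (of_int m * (-pi))"
        unfolding sin_cos_eq_iff by (rule exI[of _ m]) (simp add: algebra_simps)
      then show ?thesis by (simp add: complex_eq_iff)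
    qed
    ultimately show ?thesis unfolding F_def by metis
  qed
  ultimately have "((\<lambda>x. cis (of_int m * x)) has_integral 0) {-pi..pi}" by simp
  then show ?thesis using False by (simp add: integral_unique)
qed (simp add: scaleR_conv_of_real)

lemma fourier_coeff_add:
  assumes "continuous_on UNIV f" "continuous_on UNIV g"
  shows "fourier_coeff (\<lambda>x. f x + g x) d = fourier_coeff f d + fourier_coeff g d"
proof -
  have "integral {-pi..pi} (\<lambda>x. (f x + g x) * cis (- of_int d * x)) =
     integral {-pi..pi} (\<lambda>x. f x * cis (- of_int d * x)) + integral {-pi..pi} (\<lambda>x. g x * cis (- of_int d * x))"
    unfolding distrib_right
    by (rule integral_add; rule integrable_continuous_real)
       (auto intro!: continuous_intros continuous_on_subset[OF assms(1)] continuous_on_subset[OF assms(2)])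
  then show ?thesis by (simp add: fourier_coeff_def distrib_left)
qed

lemma fourier_coeff_trig_sum:
  assumes "finite M"
  shows "fourier_coeff (\<lambda>x. \<Sum>m\<in>M. c m * cis (of_int m * x)) d = (\<Sum>m\<in>M. if m = d then c m else 0)"
proof -
  have "integral {-pi..pi} (\<lambda>x. (\<Sum>m\<in>M. c m * cis (of_int m * x)) * cis (- of_int d * x)) =
        integral {-pi..pi} (\<lambda>x. \<Sum>m\<in>M. c m * cis (of_int (m - d) * x))"
    unfolding sum_distrib_right by (intro arg_cong[of _ _ "integral _"] ext sum.cong refl)
      (simp add: cis_mult algebra_simps)
  also have "\<dots> = (\<Sum>m\<in>M. integral {-pi..pi} (\<lambda>x. c m * cis (of_int (m - d) * x)))"
    using assms by (intro integral_sum integrable_continuous_real) (auto intro!: continuous_intros)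
  also have "\<dots> = (\<Sum>m\<in>M. 2 * of_real pi * (if m = d then c m else 0))"
    by (intro sum.cong refl) (simp only: integral_mult_right integral_cis, simp)
  finally show ?thesis by (simp add: fourier_coeff_def sum_distrib_left[symmetric])
qed

text \<open>The quadratic form of a Toeplitz matrix is an integral of its symbol against the trigonometric
polynomials with coefficients \<open>u\<close> and \<open>w\<close>. For the symbol 1 this is Parseval's identity, and in
general it bounds the matrix by its symbol.\<close>

lemma toeplitz_form_integral:
  assumes g: "continuous_on UNIV g"
  shows "(\<Sum>j<n. \<Sum>k<n. cnj (w j) * fourier_coeff g (int j - int k) * u k) =
     1 / (2 * of_real pi) * integral {-pi..pi} (\<lambda>x. g x *
        (\<Sum>k<n. u k * cis (real k * x)) * cnj (\<Sum>j<n. w j * cis (real j * x)))"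
proof -
  have "integral {-pi..pi} (\<lambda>x. g x *
        (\<Sum>k<n. u k * cis (real k * x)) * cnj (\<Sum>j<n. w j * cis (real j * x))) =
     integral {-pi..pi} (\<lambda>x. \<Sum>j<n. \<Sum>k<n. (cnj (w j) * u k) * (g x * cis (- of_int (int j - int k) * x)))"
  proof (rule arg_cong[of _ _ "integral _"], rule ext)
    fix x
    have eq: "cnj (w j) * u k * (g x * cis (- of_int (int j - int k) * x)) =
        g x * (u k * cis (real k * x)) * (cnj (w j) * cnj (cis (real j * x)))" for j k
      by (simp add: cis_cnj cis_mult algebra_simps)
    show "g x * (\<Sum>k<n. u k * cis (real k * x)) * cnj (\<Sum>j<n. w j * cis (real j * x)) =
       (\<Sum>j<n. \<Sum>k<n. (cnj (w j) * u k) * (g x * cis (- of_int (int j - int k) * x)))"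
      unfolding eq by (simp add: sum_distrib_left sum_distrib_right)
  qed
  also have "\<dots> = (\<Sum>j<n. integral {-pi..pi} (\<lambda>x. \<Sum>k<n. (cnj (w j) * u k) * (g x * cis (- of_int (int j - int k) * x))))"
    by (intro integral_sum finite_lessThan integrable_continuous_real continuous_intros continuous_on_subset[OF g] subset_UNIV)
  also have "\<dots> = (\<Sum>j<n. \<Sum>k<n. integral {-pi..pi} (\<lambda>x. (cnj (w j) * u k) * (g x * cis (- of_int (int j - int k) * x))))"
    by (intro sum.cong refl integral_sum finite_lessThan integrable_continuous_real continuous_intros continuous_on_subset[OF g] subset_UNIV)
  also have "\<dots> = (\<Sum>j<n. \<Sum>k<n. (cnj (w j) * u k) * integral {-pi..pi} (\<lambda>x. g x * cis (- of_int (int j - int k) * x)))"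
    by (simp only: integral_mult_right)
  finally show ?thesis
    by (simp add: fourier_coeff_def sum_distrib_left mult_ac)
qed

lemma trig_parseval:
  "integral {-pi..pi} (\<lambda>x. (cmod (\<Sum>k<n. u k * cis (real k * x)))\<^sup>2) = 2 * pi * (\<Sum>k<n. (cmod (u k))\<^sup>2)"
proof -
  let ?U = "\<lambda>x. \<Sum>k<n. u k * cis (real k * x)"
  have fc: "fourier_coeff (\<lambda>_. 1) d = (if d = 0 then 1 else 0)" for d
    using fourier_coeff_trig_sum[of "{0}" "\<lambda>_. 1" d] by auto
  have "(\<Sum>k<n. cnj (u j) * fourier_coeff (\<lambda>_. 1) (int j - int k) * u k) = of_real ((cmod (u j))\<^sup>2)"
    if "j < n" for j
  proof -
    have "(\<Sum>k<n. cnj (u j) * fourier_coeff (\<lambda>_. 1) (int j - int k) * u k) =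
        (\<Sum>k<n. if j = k then cnj (u j) * u k else 0)"
      by (intro sum.cong refl) (simp add: fc)
    also have "\<dots> = cnj (u j) * u j" using that by simp
    finally show ?thesis by (simp only: complex_norm_square mult.commute)
  qed
  then have "(\<Sum>j<n. \<Sum>k<n. cnj (u j) * fourier_coeff (\<lambda>_. 1) (int j - int k) * u k) = of_real (\<Sum>k<n. (cmod (u k))\<^sup>2)"
    by (simp del: of_real_power)
  then have "of_real (\<Sum>k<n. (cmod (u k))\<^sup>2) =
      1 / (2 * of_real pi) * integral {-pi..pi} (\<lambda>x. 1 * ?U x * cnj (?U x))"
    using toeplitz_form_integral[where g = "\<lambda>_. 1" and w = u and u = u and n = n, OF continuous_on_const]
    by (simp only:)
  then have "of_real (2 * pi * (\<Sum>k<n. (cmod (u k))\<^sup>2)) = integral {-pi..pi} (\<lambda>x. 1 * ?U x * cnj (?U x))"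
    by (simp only: of_real_mult) simp
  also have "\<dots> = integral {-pi..pi} (\<lambda>x. complex_of_real ((cmod (?U x))\<^sup>2))"
    by (intro arg_cong[of _ _ "integral _"] ext) (simp add: complex_norm_square del: of_real_power)
  also have "\<dots> = of_real (integral {-pi..pi} (\<lambda>x. (cmod (?U x))\<^sup>2))"
  proof -
    have "(\<lambda>x. (cmod (?U x))\<^sup>2) integrable_on {-pi..pi}"
      by (intro integrable_continuous_real continuous_intros)
    then show ?thesis by (rule integral_linear[OF _ bounded_linear_of_real, unfolded o_def])
  qed
  finally show ?thesis by (simp only: of_real_eq_iff)
qed

text \<open>With \<open>w\<close> the image of \<open>v\<close>, and \<open>U\<close>, \<open>W\<close> the trigonometric polynomials of \<open>v\<close> and \<open>w\<close>, the squared norm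
of \<open>w\<close> is the mean of \<open>g U (cnj W)\<close>. As \<open>\<eta> \<bar>U\<bar> \<bar>W\<bar> \<le> (\<eta>\<^sup>2 \<bar>U\<bar>\<^sup>2 + \<bar>W\<bar>\<^sup>2) / 2\<close>, Parseval gives
\<open>\<bar>w\<bar>\<^sup>2 \<le> (\<eta>\<^sup>2 \<bar>v\<bar>\<^sup>2 + \<bar>w\<bar>\<^sup>2) / 2\<close>, which is the claim.\<close>

lemma toeplitz_norm_le:
  assumes g: "continuous_on UNIV g" and bound: "\<And>x. cmod (g x) \<le> \<eta>" and v: "v \<in> carrier_vec n"
  shows "vnorm (toeplitz_mat n g *\<^sub>v v) \<le> \<eta> * vnorm v"
proof -
  have \<eta>: "0 \<le> \<eta>" using bound[of 0] norm_ge_zero order_trans by blast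
  define w where "w = toeplitz_mat n g *\<^sub>v v"
  have w: "w \<in> carrier_vec n" using v by (auto simp: w_def intro!: carrier_vecI)
  let ?U = "\<lambda>x. \<Sum>k<n. v $ k * cis (real k * x)"
  let ?W = "\<lambda>x. \<Sum>k<n. w $ k * cis (real k * x)"
  have wj: "w $ j = (\<Sum>k<n. fourier_coeff g (int j - int k) * v $ k)" if "j < n" for j
    using that v carrier_matD[OF toeplitz_carrier]
    by (simp add: w_def scalar_prod_def atLeast0LessThan toeplitz_index)
  have U: "integral {-pi..pi} (\<lambda>x. (cmod (?U x))\<^sup>2) = 2 * pi * (vnorm v)\<^sup>2"
    and W: "integral {-pi..pi} (\<lambda>x. (cmod (?W x))\<^sup>2) = 2 * pi * (vnorm w)\<^sup>2"
    using v w by (simp_all only: trig_parseval vnorm_square carrier_vecD)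
  have "complex_of_real ((vnorm w)\<^sup>2) = (\<Sum>j<n. cnj (w $ j) * w $ j)"
    unfolding vnorm_cscalar using w by (simp add: scalar_prod_def atLeast0LessThan mult.commute)
  also have "\<dots> = (\<Sum>j<n. \<Sum>k<n. cnj (w $ j) * fourier_coeff g (int j - int k) * v $ k)"
    by (intro sum.cong refl) (subst (2) wj, simp_all add: sum_distrib_left mult.assoc)
  also have "\<dots> = 1 / (2 * of_real pi) * integral {-pi..pi} (\<lambda>x. g x * ?U x * cnj (?W x))"
    by (rule toeplitz_form_integral[OF g])
  finally have "cmod (complex_of_real ((vnorm w)\<^sup>2)) = cmod (1 / (2 * of_real pi) * integral {-pi..pi} (\<lambda>x. g x * ?U x * cnj (?W x)))"
    by (rule arg_cong)
  then have "(vnorm w)\<^sup>2 = 1 / (2 * pi) * cmod (integral {-pi..pi} (\<lambda>x. g x * ?U x * cnj (?W x)))"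
    by (simp add: norm_mult norm_divide del: of_real_power)
  also have "\<dots> \<le> 1 / (2 * pi) * integral {-pi..pi} (\<lambda>x. \<eta>\<^sup>2 / 2 * (cmod (?U x))\<^sup>2 + 1 / 2 * (cmod (?W x))\<^sup>2)"
  proof (intro mult_left_mono integral_norm_bound_integral)
    show "(\<lambda>x. g x * ?U x * cnj (?W x)) integrable_on {-pi..pi}"
      by (intro integrable_continuous_real continuous_intros continuous_on_subset[OF g]) auto
    show "(\<lambda>x. \<eta>\<^sup>2 / 2 * (cmod (?U x))\<^sup>2 + 1 / 2 * (cmod (?W x))\<^sup>2) integrable_on {-pi..pi}"
      by (intro integrable_continuous_real continuous_intros)
    fix x
    have "cmod (g x * ?U x * cnj (?W x)) \<le> (\<eta> * cmod (?U x)) * cmod (?W x)"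
      unfolding norm_mult complex_mod_cnj by (intro mult_right_mono bound) auto
    also have "\<dots> \<le> \<eta>\<^sup>2 / 2 * (cmod (?U x))\<^sup>2 + 1 / 2 * (cmod (?W x))\<^sup>2"
      using sum_squares_bound[of "\<eta> * cmod (?U x)" "cmod (?W x)"] by (simp add: power_mult_distrib field_simps)
    finally show "cmod (g x * ?U x * cnj (?W x)) \<le> \<eta>\<^sup>2 / 2 * (cmod (?U x))\<^sup>2 + 1 / 2 * (cmod (?W x))\<^sup>2" .
  qed auto
  also have "integral {-pi..pi} (\<lambda>x. \<eta>\<^sup>2 / 2 * (cmod (?U x))\<^sup>2 + 1 / 2 * (cmod (?W x))\<^sup>2) =
      \<eta>\<^sup>2 / 2 * (2 * pi * (vnorm v)\<^sup>2) + 1 / 2 * (2 * pi * (vnorm w)\<^sup>2)"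
    unfolding U[symmetric] W[symmetric] integral_mult_right[symmetric]
    by (intro integral_add integrable_continuous_real continuous_intros)
  finally have "(vnorm w)\<^sup>2 \<le> (\<eta> * vnorm v)\<^sup>2" by (simp add: field_simps power_mult_distrib)
  then show ?thesis unfolding w_def[symmetric] using \<eta> by (simp add: power2_le_iff_abs_le)
qed

section \<open>Circulant matrices\<close>

lemma sum_roots_of_unity:
  assumes n: "0 < n"
  shows "(\<Sum>l<n. cis (2 * pi * real l * of_int d / real n)) = (if int n dvd d then of_nat n else 0)"
proof -
  let ?z = "cis (2 * pi * of_int d / real n)"
  have pow: "cis (2 * pi * real l * of_int d / real n) = ?z ^ l" for l
    by (simp add: Complex.DeMoivre mult_ac)
  have one: "?z = 1 \<longleftrightarrow> int n dvd d"
  proof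
    assume "?z = 1"
    then have "sin (2 * pi * of_int d / real n) = sin 0 \<and> cos (2 * pi * of_int d / real n) = cos 0"
      by (simp add: complex_eq_iff)
    then obtain k :: int where "2 * pi * of_int d / real n = 2 * pi * of_int k"
      unfolding sin_cos_eq_iff by auto
    then have "real_of_int d = real_of_int (int n * k)" using n by (simp add: field_simps)
    then show "int n dvd d" by (simp only: of_int_eq_iff) simp
  next
    assume "int n dvd d"
    then obtain k where "d = int n * k" by blast
    then have "2 * pi * of_int d / real n = 2 * pi * of_int k" using n by (simp add: field_simps)
    then show "?z = 1" by (simp only: cis_multiple_2pi[OF Ints_of_int])
  qed
  have "?z ^ n = 1"
  proof -
    have "?z ^ n = cis (2 * pi * of_int d)" using n by (simp add: Complex.DeMoivre)
    then show ?thesis by (simp only: cis_multiple_2pi[OF Ints_of_int])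
  qed
  then show ?thesis unfolding pow using one by (auto simp: sum_gp_strict)
qed

lemma fourier_carrier [simp]: "fourier_mat n \<in> carrier_mat n n"
  by (simp add: fourier_mat_def Let_def)

lemma fourier_dims [simp]: "dim_row (fourier_mat n) = n" "dim_col (fourier_mat n) = n"
  by (simp_all add: fourier_mat_def Let_def)

lemma fourier_index:
  "j < n \<Longrightarrow> k < n \<Longrightarrow> fourier_mat n $$ (j, k) = cis (2 * pi * real j * real k / real n) / of_real (sqrt (real n))"
proof -
  have "exp (2 * of_real pi * \<i> / of_nat n) = cis (2 * pi / real n)"
    by (simp add: cis_conv_exp mult_ac)
  then show "j < n \<Longrightarrow> k < n \<Longrightarrow> ?thesis"
    by (simp add: fourier_mat_def Let_def Complex.DeMoivre mult_ac)
qed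

lemma fourier_index_product:
  assumes "l < n" "j < n" "k < n"
  shows "cnj (fourier_mat n $$ (l, j)) * fourier_mat n $$ (l, k) =
    cis (2 * pi * real l * of_int (int k - int j) / real n) / of_nat n"
proof -
  have sq: "complex_of_real (sqrt (real n)) * complex_of_real (sqrt (real n)) = of_nat n"
    by (simp flip: of_real_mult)
  have "cnj (fourier_mat n $$ (l, j)) * fourier_mat n $$ (l, k) =
     (cis (- (2 * pi * real l * real j / real n)) * cis (2 * pi * real l * real k / real n)) / of_nat n"
    using assms by (simp add: fourier_index cis_cnj sq)
  then show ?thesis by (simp add: cis_mult diff_divide_distrib algebra_simps)
qed

lemma fourier_unitary: "mat_adjoint (fourier_mat n) * fourier_mat n = 1\<^sub>m n"
proof (rule eq_matI)
  fix j k assume "j < dim_row (1\<^sub>m n :: complex mat)" "k < dim_col (1\<^sub>m n :: complex mat)"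
  then have j: "j < n" and k: "k < n" by auto
  have "(mat_adjoint (fourier_mat n) * fourier_mat n) $$ (j, k) =
      (\<Sum>l<n. cnj (fourier_mat n $$ (l, j)) * fourier_mat n $$ (l, k))"
    using j k carrier_matD[OF fourier_carrier[of n]]
    by (simp add: scalar_prod_def atLeast0LessThan mat_adjoint_index[OF fourier_carrier])
  also have "\<dots> = (\<Sum>l<n. cis (2 * pi * real l * of_int (int k - int j) / real n) / of_nat n)"
    using j k by (intro sum.cong refl) (simp add: fourier_index_product)
  also have "\<dots> = (if int n dvd int k - int j then 1 else 0)"
    using sum_roots_of_unity[of n "int k - int j"] j by (simp flip: sum_divide_distrib)
  also have "int n dvd int k - int j \<longleftrightarrow> j = k"
    using zdvd_imp_le[of "int n" "int k - int j"] zdvd_imp_le[of "int n" "int j - int k"] j k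
      dvd_diff_commute[of "int n" "int k" "int j"]
    by (cases j k rule: linorder_cases) auto
  finally show "(mat_adjoint (fourier_mat n) * fourier_mat n) $$ (j, k) = (1\<^sub>m n :: complex mat) $$ (j, k)"
    using j k by simp
qed (use carrier_matD[OF fourier_carrier[of n]] in auto)

lemma fourier_unitary_right: "fourier_mat n * mat_adjoint (fourier_mat n) = 1\<^sub>m n"
  using mat_mult_left_right_inverse[OF mat_adjoint_carrier[OF fourier_carrier] fourier_carrier fourier_unitary] .

lemma circulant_eigenvalue_carrier [simp]: "circulant_eigenvalue_mat n f \<in> carrier_mat n n"
  by (simp add: circulant_eigenvalue_mat_def mat_diag_def)

lemma circulant_carrier [simp]: "circulant_mat n f \<in> carrier_mat n n"
  unfolding circulant_mat_def
  by (intro mult_carrier_mat[of _ n n] mat_adjoint_carrier fourier_carrier circulant_eigenvalue_carrier)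

lemma circulant_dims [simp]: "dim_row (circulant_mat n f) = n" "dim_col (circulant_mat n f) = n"
  using carrier_matD[OF circulant_carrier[of n f]] by simp_all

lemma circulant_index:
  assumes j: "j < n" and k: "k < n"
  shows "circulant_mat n f $$ (j, k) =
    (\<Sum>l<n. f (2 * pi * real l / real n) * cis (2 * pi * real l * of_int (int k - int j) / real n)) / of_nat n"
proof -
  have "circulant_mat n f = mat_adjoint (fourier_mat n) * (circulant_eigenvalue_mat n f * fourier_mat n)"
    unfolding circulant_mat_def
    by (rule assoc_mult_mat[OF mat_adjoint_carrier[OF fourier_carrier] circulant_eigenvalue_carrier fourier_carrier])
  also have "circulant_eigenvalue_mat n f * fourier_mat n =
      Matrix.mat n n (\<lambda>(l, k). f (2 * pi * real l / real n) * fourier_mat n $$ (l, k))"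
    unfolding circulant_eigenvalue_mat_def by (rule mat_diag_mult_left[OF fourier_carrier])
  finally have "circulant_mat n f $$ (j, k) =
      (\<Sum>l<n. cnj (fourier_mat n $$ (l, j)) * (f (2 * pi * real l / real n) * fourier_mat n $$ (l, k)))"
    using j k carrier_matD[OF fourier_carrier[of n]]
    by (simp add: scalar_prod_def atLeast0LessThan mat_adjoint_index[OF fourier_carrier])
  also have "\<dots> = (\<Sum>l<n. f (2 * pi * real l / real n) * cis (2 * pi * real l * of_int (int k - int j) / real n) / of_nat n)"
    using j k by (intro sum.cong refl) (simp add: mult.left_commute[of "cnj _"] fourier_index_product)
  finally show ?thesis by (simp add: sum_divide_distrib)
qed

lemma mat_diag_mult_vec:
  fixes y :: "'a :: comm_semiring_1 vec"
  assumes y: "y \<in> carrier_vec n" and k: "k < n"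
  shows "(mat_diag n h *\<^sub>v y) $ k = h k * y $ k"
proof -
  have "(mat_diag n h *\<^sub>v y) $ k = (\<Sum>i<n. (if k = i then h i else 0) * y $ i)"
    using assms by (simp add: mat_diag_def scalar_prod_def atLeast0LessThan)
  also have "\<dots> = (\<Sum>i<n. if k = i then h i * y $ i else 0)"
    by (intro sum.cong refl) simp
  finally show ?thesis using k by simp
qed

text \<open>The unitary Fourier matrix reduces the norm to that of the diagonal factor, so pointwise bounds on
the symbol become bounds on the circulant matrix, from above as well as from below.\<close>

lemma circulant_norm:
  assumes v: "v \<in> carrier_vec n"
  shows "vnorm (circulant_mat n f *\<^sub>v v) =
    L2_set (\<lambda>k. cmod (f (2 * pi * real k / real n)) * cmod ((fourier_mat n *\<^sub>v v) $ k)) {..<n}"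
proof -
  let ?F = "fourier_mat n" and ?D = "circulant_eigenvalue_mat n f"
  note aF = mat_adjoint_carrier[OF fourier_carrier[of n]]
  have Fv: "?F *\<^sub>v v \<in> carrier_vec n" using fourier_carrier v by (rule mult_mat_vec_carrier)
  have "circulant_mat n f *\<^sub>v v = mat_adjoint ?F *\<^sub>v (?D *\<^sub>v (?F *\<^sub>v v))"
    unfolding circulant_mat_def
    by (simp only: assoc_mult_mat_vec[OF mult_carrier_mat[OF aF circulant_eigenvalue_carrier] fourier_carrier v]
        assoc_mult_mat_vec[OF aF circulant_eigenvalue_carrier Fv])
  then have "vnorm (circulant_mat n f *\<^sub>v v) = vnorm (?D *\<^sub>v (?F *\<^sub>v v))"
    using vnorm_isometry[OF aF, of "?D *\<^sub>v (?F *\<^sub>v v)"] mult_mat_vec_carrier[OF circulant_eigenvalue_carrier Fv]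
    by (simp add: mat_adjoint_mat_adjoint fourier_unitary_right)
  moreover have "(?D *\<^sub>v (?F *\<^sub>v v)) $ k = f (2 * pi * real k / real n) * (?F *\<^sub>v v) $ k" if "k < n" for k
    unfolding circulant_eigenvalue_mat_def by (rule mat_diag_mult_vec[OF Fv that])
  moreover have "dim_vec (?D *\<^sub>v (?F *\<^sub>v v)) = n"
    by (rule carrier_vecD[OF mult_mat_vec_carrier[OF circulant_eigenvalue_carrier Fv]])
  ultimately show ?thesis by (simp only: vnorm_def) (simp add: norm_mult L2_set_def)
qed

lemma circulant_norm_le:
  assumes v: "v \<in> carrier_vec n" and bound: "\<And>x. cmod (f x) \<le> \<eta>"
  shows "vnorm (circulant_mat n f *\<^sub>v v) \<le> \<eta> * vnorm v"
proof -
  have \<eta>: "0 \<le> \<eta>" using bound[of 0] norm_ge_zero order_trans by blast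
  have Fv: "fourier_mat n *\<^sub>v v \<in> carrier_vec n" using fourier_carrier v by (rule mult_mat_vec_carrier)
  have "vnorm (circulant_mat n f *\<^sub>v v) \<le> L2_set (\<lambda>k. \<eta> * cmod ((fourier_mat n *\<^sub>v v) $ k)) {..<n}"
    unfolding circulant_norm[OF v] by (intro L2_set_mono mult_right_mono bound) auto
  also have "\<dots> = \<eta> * vnorm (fourier_mat n *\<^sub>v v)"
    using Fv \<eta> by (simp add: vnorm_def L2_set_right_distrib)
  finally show ?thesis using vnorm_isometry[OF fourier_carrier fourier_unitary v] by simp
qed

lemma circulant_norm_ge:
  assumes v: "v \<in> carrier_vec n" and bound: "\<And>x. \<mu> \<le> cmod (f x)" and \<mu>: "0 \<le> \<mu>"
  shows "\<mu> * vnorm v \<le> vnorm (circulant_mat n f *\<^sub>v v)"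
proof -
  have Fv: "fourier_mat n *\<^sub>v v \<in> carrier_vec n" using fourier_carrier v by (rule mult_mat_vec_carrier)
  have "\<mu> * vnorm (fourier_mat n *\<^sub>v v) = L2_set (\<lambda>k. \<mu> * cmod ((fourier_mat n *\<^sub>v v) $ k)) {..<n}"
    using Fv \<mu> by (simp add: vnorm_def L2_set_right_distrib)
  also have "\<dots> \<le> vnorm (circulant_mat n f *\<^sub>v v)"
    unfolding circulant_norm[OF v] by (intro L2_set_mono mult_right_mono bound) (auto simp: \<mu>)
  finally show ?thesis using vnorm_isometry[OF fourier_carrier fourier_unitary v] by simp
qed

text \<open>The entry of the circulant matrix is the sum of all \<open>c m\<close> with \<open>m\<close> congruent to \<open>j - k\<close> modulo \<open>n\<close>, and
that of the Toeplitz matrix is \<open>c (j - k)\<close> alone. For an inner row and \<open>m \<in> M\<close>, \<open>m - (j - k)\<close> is less than \<open>n\<close> in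
absolute value, so that the two conditions on \<open>m\<close> coincide.\<close>

lemma toeplitz_eq_circulant_inner_rows:
  fixes c :: "int \<Rightarrow> complex"
  assumes M: "M \<subseteq> {-int N..int N}" and j: "N \<le> j" "j < n - N" and k: "k < n"
  defines "p \<equiv> \<lambda>x. \<Sum>m\<in>M. c m * cis (of_int m * x)"
  shows "toeplitz_mat n p $$ (j, k) = circulant_mat n p $$ (j, k)"
proof -
  have fin: "finite M" using M finite_subset by blast
  have jn: "j < n" using j by simp
  have n: "0 < n" using k by simp
  have eq: "int n dvd m + (int k - int j) \<longleftrightarrow> m = int j - int k" if "m \<in> M" for m
  proof -
    have "- int N \<le> m" "m \<le> int N" using that M by auto
    moreover have "int N \<le> int j" "int j + int N < int n" "int k < int n" using j k by auto
    ultimately have "\<bar>m + (int k - int j)\<bar> < int n" by linarith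
    then have "int n dvd m + (int k - int j) \<longleftrightarrow> m + (int k - int j) = 0"
      using dvd_imp_le_int[of "m + (int k - int j)" "int n"] by auto
    also have "\<dots> \<longleftrightarrow> m = int j - int k" by linarith
    finally show ?thesis .
  qed
  have "circulant_mat n p $$ (j, k) = (\<Sum>l<n. \<Sum>m\<in>M. c m * cis (2 * pi * real l * of_int (m + (int k - int j)) / real n)) / of_nat n"
    unfolding circulant_index[OF jn k] p_def sum_distrib_right
  proof (intro arg_cong[of _ _ "\<lambda>z. z / _"] sum.cong refl)
    fix l m
    have "cis (of_int m * (2 * pi * real l / real n)) * cis (2 * pi * real l * of_int (int k - int j) / real n) =
      cis (2 * pi * real l * of_int (m + (int k - int j)) / real n)"
      unfolding cis_mult by (rule arg_cong[of _ _ cis]) (use n in \<open>simp add: field_simps\<close>)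
    then show "c m * cis (of_int m * (2 * pi * real l / real n)) * cis (2 * pi * real l * of_int (int k - int j) / real n) =
      c m * cis (2 * pi * real l * of_int (m + (int k - int j)) / real n)" by (simp only: mult.assoc)
  qed
  also have "\<dots> = (\<Sum>m\<in>M. c m * (\<Sum>l<n. cis (2 * pi * real l * of_int (m + (int k - int j)) / real n))) / of_nat n"
    by (subst sum.swap) (simp add: sum_distrib_left)
  also have "\<dots> = (\<Sum>m\<in>M. if m = int j - int k then c m else 0)"
    unfolding sum_roots_of_unity[OF n] sum_divide_distrib using n eq by (intro sum.cong refl) auto
  also have "\<dots> = toeplitz_mat n p $$ (j, k)"
    unfolding toeplitz_index[OF jn k] p_def fourier_coeff_trig_sum[OF fin] ..
  finally show ?thesis by simp
qed

section \<open>The preconditioned Toeplitz matrix\<close>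

lemma trig_poly_continuous: "is_trig_poly p \<Longrightarrow> continuous_on A p"
  unfolding is_trig_poly_def by (auto intro!: continuous_intros)

lemma toeplitz_add:
  assumes "continuous_on UNIV f" "continuous_on UNIV g"
  shows "toeplitz_mat n (\<lambda>x. f x + g x) = toeplitz_mat n f + toeplitz_mat n g"
  by (rule eq_matI)
     (use carrier_matD[OF toeplitz_carrier] in \<open>auto simp: toeplitz_index fourier_coeff_add[OF assms]\<close>)

lemma circulant_add: "circulant_mat n (\<lambda>x. f x + g x) = circulant_mat n f + circulant_mat n g"
  by (rule eq_matI)
     (use carrier_matD[OF circulant_carrier] in
       \<open>auto simp: circulant_index distrib_right sum.distrib add_divide_distrib\<close>)

lemma circulant_inverse:
  assumes \<mu>: "0 < \<mu>" and bound: "\<And>x. \<mu> \<le> cmod (f x)"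
  shows "inverse_mat (circulant_mat n f) \<in> carrier_mat n n"
    "circulant_mat n f * inverse_mat (circulant_mat n f) = 1\<^sub>m n"
proof -
  let ?C = "circulant_mat n f"
  have "v = 0\<^sub>v n" if v: "v \<in> carrier_vec n" "?C *\<^sub>v v = 0\<^sub>v n" for v
  proof -
    have "vnorm (?C *\<^sub>v v) = 0" using v vnorm_eq_0[of "0\<^sub>v n" n] by simp
    moreover have "\<mu> * vnorm v \<le> vnorm (?C *\<^sub>v v)"
      using circulant_norm_ge[OF v(1) bound] \<mu> by simp
    ultimately have "vnorm v \<le> 0" using \<mu> by (simp add: mult_le_0_iff)
    then have "vnorm v = 0" using vnorm_nonneg[of v] by simp
    then show ?thesis using vnorm_eq_0[OF v(1)] by simp
  qed
  then have "det ?C \<noteq> 0" using det_0_iff_vec_prod_zero[OF circulant_carrier, of n f] by blast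
  then have "?C \<in> Units (ring_mat TYPE(complex) n ())"
    by (rule det_non_zero_imp_unit[OF circulant_carrier])
  then have "mat_inverse ?C \<noteq> None"
    using mat_inverse(1)[OF circulant_carrier, of n f "()"] by argo
  then obtain B where B: "mat_inverse ?C = Some B" by blast
  then show "inverse_mat ?C \<in> carrier_mat n n" "?C * inverse_mat ?C = 1\<^sub>m n"
    using mat_inverse(2)[OF circulant_carrier B] by (simp_all add: inverse_mat_def)
qed

text \<open>The linear forms in \<open>L\<close> are the at most \<open>2 N\<close> first and last rows of the difference of the two
matrices. For \<open>n \<le> 2 N\<close> these are all rows, so small \<open>n\<close> needs no special treatment.\<close>

lemma toeplitz_eq_circulant_on_kernel:
  fixes c :: "int \<Rightarrow> complex"
  assumes M: "M \<subseteq> {-int N..int N}"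
  defines "p \<equiv> \<lambda>x. \<Sum>m\<in>M. c m * cis (of_int m * x)"
  obtains L where "set L \<subseteq> carrier_vec n" "length L \<le> 2 * N"
    "\<And>v. v \<in> carrier_vec n \<Longrightarrow> (\<And>l. l \<in> set L \<Longrightarrow> l \<bullet> v = 0) \<Longrightarrow>
      toeplitz_mat n p *\<^sub>v v = circulant_mat n p *\<^sub>v v"
proof -
  let ?T = "toeplitz_mat n p" and ?C = "circulant_mat n p"
  define bad where "bad = filter (\<lambda>j. j < N \<or> n - N \<le> j) [0..<n]"
  define L where "L = map (row (?T - ?C)) bad"
  have Q: "?T - ?C \<in> carrier_mat n n" by (intro minus_carrier_mat circulant_carrier)
  show thesis
  proof
    show "set L \<subseteq> carrier_vec n" using Q by (auto simp: L_def intro!: carrier_vecI)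
    have "distinct bad" by (simp add: bad_def)
    then have "length L = card (set bad)" by (simp only: L_def length_map distinct_card)
    also have "\<dots> \<le> card ({..<N} \<union> {n - N..<n})" by (rule card_mono) (auto simp: bad_def)
    also have "\<dots> \<le> 2 * N" by (rule order_trans[OF card_Un_le]) auto
    finally show "length L \<le> 2 * N" .
    fix v assume v: "v \<in> carrier_vec n" and ker: "\<And>l. l \<in> set L \<Longrightarrow> l \<bullet> v = 0"
    have rows: "row ?T j \<bullet> v = row ?C j \<bullet> v" if j: "j < n" for j
    proof (cases "j < N \<or> n - N \<le> j")
      case True
      then have "row (?T - ?C) j \<bullet> v = 0" using j by (intro ker) (auto simp: L_def bad_def)
      moreover have "row (?T - ?C) j = row ?T j - row ?C j"
        using j carrier_matD[OF toeplitz_carrier[of n p]] carrier_matD[OF circulant_carrier[of n p]]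
        by (intro eq_vecI) auto
      ultimately show ?thesis
        using v minus_scalar_prod_distrib[of "row ?T j" n "row ?C j" v]
          row_carrier_vec[OF j toeplitz_carrier[of n p]] row_carrier_vec[OF j circulant_carrier[of n p]]
        by simp
    next
      case False
      have "row ?T j = row ?C j"
        using j False carrier_matD[OF toeplitz_carrier[of n p]] carrier_matD[OF circulant_carrier[of n p]]
          toeplitz_eq_circulant_inner_rows[OF M, of j n _ c]
        by (intro eq_vecI) (auto simp: p_def)
      then show ?thesis by simp
    qed
    show "?T *\<^sub>v v = ?C *\<^sub>v v"
      by (rule eq_vecI) (use rows carrier_matD[OF toeplitz_carrier[of n p]]
          carrier_matD[OF circulant_carrier[of n p]] in auto)
  qed
qed

text \<open>Comparing \<open>B v\<close> with \<open>v\<close> after multiplication by the circulant matrix avoids any estimate of its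
inverse: the image of \<open>w = B v - v\<close> is the difference of the matrices of \<open>g\<close> applied to \<open>v\<close>, and the
lower bound \<open>\<mu>\<close> then controls \<open>w\<close> itself.\<close>

lemma preconditioned_toeplitz_norm_bounds:
  assumes f: "\<And>x. f x = p x + g x" and p: "continuous_on UNIV p" and g: "continuous_on UNIV g"
    and \<mu>: "0 < \<mu>" "\<And>x. \<mu> \<le> cmod (f x)" and small: "\<And>x. cmod (g x) \<le> \<mu> * e / 2"
    and v: "v \<in> carrier_vec n" and eq: "toeplitz_mat n p *\<^sub>v v = circulant_mat n p *\<^sub>v v"
  defines "B \<equiv> inverse_mat (circulant_mat n f) * toeplitz_mat n f"
  shows "(1 - e) * vnorm v \<le> vnorm (B *\<^sub>v v)" "vnorm (B *\<^sub>v v) \<le> (1 + e) * vnorm v"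
proof -
  let ?C = "circulant_mat n" and ?T = "toeplitz_mat n" and ?I = "inverse_mat (circulant_mat n f)"
  have feq: "f = (\<lambda>x. p x + g x)" using f by blast
  note I = circulant_inverse[OF \<mu>, of n]
  have c [simp]: "?T h *\<^sub>v v \<in> carrier_vec n" "?C h *\<^sub>v v \<in> carrier_vec n" for h
    by (rule mult_mat_vec_carrier[OF toeplitz_carrier v] mult_mat_vec_carrier[OF circulant_carrier v])+
  have Bv: "B *\<^sub>v v = ?I *\<^sub>v (?T f *\<^sub>v v)"
    unfolding B_def by (rule assoc_mult_mat_vec[OF I(1) toeplitz_carrier v])
  have Bc: "B *\<^sub>v v \<in> carrier_vec n" unfolding Bv by (rule mult_mat_vec_carrier[OF I(1)]) simp
  define w where "w = B *\<^sub>v v - v"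
  have w: "w \<in> carrier_vec n" using Bc v by (simp add: w_def)
  have "?C f *\<^sub>v (B *\<^sub>v v) = ?T f *\<^sub>v v"
    unfolding Bv assoc_mult_mat_vec[OF circulant_carrier I(1) c(1), symmetric] I(2) by simp
  then have "?C f *\<^sub>v w = ?T f *\<^sub>v v - ?C f *\<^sub>v v"
    using mult_minus_distrib_mat_vec[OF circulant_carrier Bc v] by (simp add: w_def)
  also have "\<dots> = ?T g *\<^sub>v v - ?C g *\<^sub>v v"
  proof -
    have "?T f *\<^sub>v v = ?T p *\<^sub>v v + ?T g *\<^sub>v v"
      unfolding feq toeplitz_add[OF p g] by (rule add_mult_distrib_mat_vec[OF toeplitz_carrier toeplitz_carrier v])
    moreover have "?C f *\<^sub>v v = ?C p *\<^sub>v v + ?C g *\<^sub>v v"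
      unfolding feq circulant_add by (rule add_mult_distrib_mat_vec[OF circulant_carrier circulant_carrier v])
    moreover have "x + y - (x + z) = y - z"
      if "x \<in> carrier_vec n" "y \<in> carrier_vec n" "z \<in> carrier_vec n" for x y z :: "complex vec"
      using that by (intro eq_vecI) auto
    ultimately show ?thesis using eq by simp
  qed
  finally have Cw: "?C f *\<^sub>v w = ?T g *\<^sub>v v - ?C g *\<^sub>v v" .
  have "\<mu> * vnorm w \<le> vnorm (?C f *\<^sub>v w)" using circulant_norm_ge[OF w \<mu>(2)] \<mu>(1) by simp
  also have "\<dots> \<le> vnorm (?T g *\<^sub>v v) + vnorm (?C g *\<^sub>v v)"
    unfolding Cw by (rule vnorm_minus[OF c(1) c(2)])
  also have "\<dots> \<le> \<mu> * e / 2 * vnorm v + \<mu> * e / 2 * vnorm v"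
    by (intro add_mono toeplitz_norm_le circulant_norm_le g small v)
  finally have "\<mu> * vnorm w \<le> \<mu> * (e * vnorm v)" by simp
  then have we: "vnorm w \<le> e * vnorm v" using \<mu>(1) by simp
  have "x = v + (x - v) \<and> v = x - (x - v)" if "x \<in> carrier_vec n" for x
    using that v by (auto intro!: eq_vecI)
  from this[OF Bc] have "B *\<^sub>v v = v + w" "v = B *\<^sub>v v - w"
    by (simp_all only: w_def)
  then have "vnorm (B *\<^sub>v v) \<le> vnorm v + vnorm w" "vnorm v \<le> vnorm (B *\<^sub>v v) + vnorm w"
    using vnorm_add[OF v w] vnorm_minus[OF Bc w] by metis+
  then show "(1 - e) * vnorm v \<le> vnorm (B *\<^sub>v v)" "vnorm (B *\<^sub>v v) \<le> (1 + e) * vnorm v"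
    using we by (simp_all add: algebra_simps)
qed

theorem mainTheorem6:
  fixes f :: "real \<Rightarrow> complex"
  assumes periodic: "\<And>x. f (x + 2 * pi) = f x"
    and continuous: "continuous_on UNIV f"
    and no_zeros: "\<And>x. x \<in> {-pi<..pi} \<Longrightarrow> f x \<noteq> 0"
  shows "\<forall>\<epsilon>>0. proper_singular_value_cluster {1 - \<epsilon>..1 + \<epsilon>}
           (\<lambda>n. inverse_mat (circulant_mat n f) * toeplitz_mat n f)"
proof (intro allI impI, unfold proper_singular_value_cluster_def, intro allI impI)
  fix \<epsilon> \<delta> :: real assume \<epsilon>: "0 < \<epsilon>" and \<delta>: "0 < \<delta>"
  \<comment> \<open>\<open>e < \<delta>\<close> keeps \<open>{1 - e..1 + e}\<close> inside the \<open>\<delta>\<close>-ball around the point 1 of the cluster, whatever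
    \<open>\<epsilon>\<close> is, and \<open>e < 1\<close> keeps the lower distortion factor \<open>1 - e\<close> nonnegative.\<close>
  define e where "e = min (\<delta> / 2) (1 / 2)"
  have e: "0 < e" "e < \<delta>" "e < 1" using \<delta> by (auto simp: e_def)
  obtain \<mu> where \<mu>: "0 < \<mu>" "\<And>x. \<mu> \<le> cmod (f x)"
    using periodic_nonzero_bounded_below[OF periodic continuous no_zeros] by blast
  obtain p where p: "is_trig_poly p" "\<And>x. cmod (f x - p x) < \<mu> * e / 2"
    using trig_poly_approximation[OF periodic continuous, of "\<mu> * e / 2"] \<mu>(1) e(1) by auto
  obtain M c where M: "finite M" and pM: "p = (\<lambda>x. \<Sum>m\<in>M. c m * cis (of_int m * x))"
    using p(1) unfolding is_trig_poly_def by blast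
  \<comment> \<open>The sum of all absolute values is a crude but sufficient bound for the degree.\<close>
  obtain N where N: "M \<subseteq> {-int N..int N}"
  proof -
    have "m \<in> {-int (nat (\<Sum>m\<in>M. \<bar>m\<bar>))..int (nat (\<Sum>m\<in>M. \<bar>m\<bar>))}" if "m \<in> M" for m
      using member_le_sum[OF that, of abs] M by auto
    then show thesis using that by blast
  qed
  define g where "g x = f x - p x" for x
  have pc: "continuous_on UNIV p" using trig_poly_continuous[OF p(1)] .
  have gc: "continuous_on UNIV g" unfolding g_def by (intro continuous_intros continuous pc)
  show "\<exists>c. \<forall>n\<ge>1. size {#\<sigma> \<in># singular_values (inverse_mat (circulant_mat n f) * toeplitz_mat n f).
            \<sigma> \<notin> ball_extension \<delta> {1 - \<epsilon>..1 + \<epsilon>}#} \<le> c"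
  proof (intro exI[of _ "4 * N"] allI impI)
    fix n :: nat
    let ?B = "inverse_mat (circulant_mat n f) * toeplitz_mat n f"
    obtain L where L: "set L \<subseteq> carrier_vec n" "length L \<le> 2 * N"
      "\<And>v. v \<in> carrier_vec n \<Longrightarrow> (\<And>l. l \<in> set L \<Longrightarrow> l \<bullet> v = 0) \<Longrightarrow>
        toeplitz_mat n p *\<^sub>v v = circulant_mat n p *\<^sub>v v"
      using toeplitz_eq_circulant_on_kernel[OF N, of n c] unfolding pM by blast
    have "{1 - e..1 + e} \<subseteq> ball_extension \<delta> {1 - \<epsilon>..1 + \<epsilon>}"
    proof
      fix s assume "s \<in> {1 - e..1 + e}"
      then have "s \<in> ball 1 \<delta>" using e by (auto simp: dist_real_def)
      moreover have "1 \<in> {1 - \<epsilon>..1 + \<epsilon>}" using \<epsilon> by simp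
      ultimately show "s \<in> ball_extension \<delta> {1 - \<epsilon>..1 + \<epsilon>}" unfolding ball_extension_def by blast
    qed
    then have "size {#\<sigma> \<in># singular_values ?B. \<sigma> \<notin> ball_extension \<delta> {1 - \<epsilon>..1 + \<epsilon>}#}
        \<le> size {#\<sigma> \<in># singular_values ?B. \<sigma> \<notin> {1 - e..1 + e}#}"
      by (intro size_mset_mono filter_mset_mono_strong) auto
    also have "\<dots> \<le> 2 * length L"
    proof (rule few_singular_values_outside)
      show "?B \<in> carrier_mat n n"
        by (rule mult_carrier_mat[OF circulant_inverse(1)[OF \<mu>] toeplitz_carrier])
      show "set L \<subseteq> carrier_vec n" by (rule L(1))
      fix v :: "complex vec" assume v: "v \<in> carrier_vec n" "\<And>l. l \<in> set L \<Longrightarrow> l \<bullet> v = 0"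
      have "f x = p x + g x" "cmod (g x) \<le> \<mu> * e / 2" for x
        using p(2)[of x] by (simp_all add: g_def)
      from preconditioned_toeplitz_norm_bounds[OF this(1) pc gc \<mu> this(2) v(1) L(3)[OF v]]
      show "(1 - e) * vnorm v \<le> vnorm (?B *\<^sub>v v) \<and> vnorm (?B *\<^sub>v v) \<le> (1 + e) * vnorm v" by blast
    qed (use e in auto)
    finally show "size {#\<sigma> \<in># singular_values ?B. \<sigma> \<notin> ball_extension \<delta> {1 - \<epsilon>..1 + \<epsilon>}#} \<le> 4 * N"
      using L(2) by simp
  qed
qed

end
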